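(* Assume that a weighted quadrant model has an infinite group of the walk. The following are equivalent: (1) the model is decoupled, i.e. there exist $f(x)\in\mathbb{C}(x)$ and $g(y)\in\mathbb{C}(y)$ such that $xy=f(x)+g(y)$ in $\mathbb{C}(\overline{E_t})$ (such a pair is called a decoupling pair for $xy$); (2) the element $b=x(\iota_1(y)-y)$ has a certificate in $\mathbb{C}(\overline{E_t})$, i.e. there exists $g\in\mathbb{C}(\overline{E_t})$ with $b=\tau(g)-g$. In fact, if $(f(x),g(y))$ is a decoupling pair for $xy$, then $g(y)$ is a certificate for $b$; and if $g$ is a certificate for $b$, then $(f=xy-g,\;g)$ is a decoupling pair for $xy$.
   Context: Weighted model: a family of weights $d_{i,j}$, $(i,j)\in\{-1,0,1\}^2$, and a fixed $t\in\mathbb{C}$ transcendental over $\mathbb{Q}$. Kernel: $K(x,y,t)=xy\bigl(1-t\sum_{i,j}d_{i,j}x^iy^j\bigr)$, assumed irreducible in $\mathbb{C}[x,y]$ and of degree $2$ in each of $x$ and $y$. $\overline{E_t}$ is the curve in $\mathbb{P}^1(\mathbb{C})\times\mathbb{P}^1(\mathbb{C})$ obtained by bihomogenizing $K(x,y,t)=0$ (genus $0$ or $1$), with function field $\mathbb{C}(\overline{E_t})=\mathrm{Frac}\,\mathbb{C}[x,y]/(K(x,y,t))$. $\mathbb{C}(\overline{E_t})$ has degree $2$ over each of its subfields $\mathbb{C}(x)$ and $\mathbb{C}(y)$; $\iota_1$ (resp. $\iota_2$) is the nontrivial automorphism of $\mathbb{C}(\overline{E_t})$ fixing $\mathbb{C}(x)$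 (resp. $\mathbb{C}(y)$). The group of the walk is the group generated by $\iota_1,\iota_2$. On $\mathbb{C}(\overline{E_t})$, $\tau=\iota_1\circ\iota_2$. *)

theory Defs
  imports "HOL-Algebra.Algebraic_Closure_Type" "HOL-Algebra.Generated_Fields" "HOL-Algebra.Bij"
begin

section \<open>The field of fractions of a domain\<close>

definition frac_rel :: "('a, 'm) ring_scheme \<Rightarrow> (('a \<times> 'a) \<times> ('a \<times> 'a)) set" where
  "frac_rel R = {((a, b), (c, d)) | a b c d.
     a \<in> carrier R \<and> b \<in> carrier R - {\<zero>\<^bsub>R\<^esub>} \<and> c \<in> carrier R \<and> d \<in> carrier R - {\<zero>\<^bsub>R\<^esub>} \<and>
     a \<otimes>\<^bsub>R\<^esub> d = c \<otimes>\<^bsub>R\<^esub> b}"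

definition frac_class :: "('a, 'm) ring_scheme \<Rightarrow> 'a \<Rightarrow> 'a \<Rightarrow> ('a \<times> 'a) set" where
  "frac_class R a b = frac_rel R `` {(a, b)}"

definition Frac :: "('a, 'm) ring_scheme \<Rightarrow> ('a \<times> 'a) set ring" where
  "Frac R = \<lparr>
     carrier = (carrier R \<times> (carrier R - {\<zero>\<^bsub>R\<^esub>})) // frac_rel R,
     monoid.mult = (\<lambda>P Q. \<Union>p\<in>P. \<Union>q\<in>Q.
              frac_class R (fst p \<otimes>\<^bsub>R\<^esub> fst q) (snd p \<otimes>\<^bsub>R\<^esub> snd q)),
     one = frac_class R \<one>\<^bsub>R\<^esub> \<one>\<^bsub>R\<^esub>,
     ring.zero = frac_class R \<zero>\<^bsub>R\<^esub> \<one>\<^bsub>R\<^esub>,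
     add = (\<lambda>P Q. \<Union>p\<in>P. \<Union>q\<in>Q.
              frac_class R (fst p \<otimes>\<^bsub>R\<^esub> snd q \<oplus>\<^bsub>R\<^esub> fst q \<otimes>\<^bsub>R\<^esub> snd p)
                           (snd p \<otimes>\<^bsub>R\<^esub> snd q))\<rparr>"

context domain
begin

lemma frac_rel_iff:
  "((a, b), (c, d)) \<in> frac_rel R \<longleftrightarrow>
     a \<in> carrier R \<and> b \<in> carrier R - {\<zero>} \<and> c \<in> carrier R \<and> d \<in> carrier R - {\<zero>} \<and>
     a \<otimes> d = c \<otimes> b"
  by (auto simp: frac_rel_def)

lemma equiv_frac_rel: "equiv (carrier R \<times> (carrier R - {\<zero>})) (frac_rel R)"
proof (rule equivI)
  show "frac_rel R \<subseteq> (carrier R \<times> (carrier R - {\<zero>})) \<times> (carrier R \<times> (carrier R - {\<zero>}))"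
    by (auto simp: frac_rel_def)
  show "refl_on (carrier R \<times> (carrier R - {\<zero>})) (frac_rel R)"
    by (auto simp: refl_on_def frac_rel_def)
  show "sym (frac_rel R)" by (auto simp: sym_def frac_rel_def)
  show "trans (frac_rel R)"
  proof (rule transI)
    fix p q r assume pq: "(p, q) \<in> frac_rel R" and qr: "(q, r) \<in> frac_rel R"
    obtain a b where p: "p = (a, b)" by force
    obtain c d where q: "q = (c, d)" by force
    obtain e f where r: "r = (e, f)" by force
    have mem: "a \<in> carrier R" "b \<in> carrier R" "c \<in> carrier R" "d \<in> carrier R"
         "e \<in> carrier R" "f \<in> carrier R" "b \<noteq> \<zero>" "d \<noteq> \<zero>" "f \<noteq> \<zero>"
      and 1: "a \<otimes> d = c \<otimes> b" and 2: "c \<otimes> f = e \<otimes> d"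
      using pq qr by (auto simp: p q r frac_rel_iff)
    have "d \<otimes> (a \<otimes> f) = (a \<otimes> d) \<otimes> f" using mem by (simp add: m_ac)
    also have "\<dots> = (c \<otimes> f) \<otimes> b" using mem 1 by (simp add: m_ac)
    also have "\<dots> = d \<otimes> (e \<otimes> b)" using mem 2 by (simp add: m_ac)
    finally have "a \<otimes> f = e \<otimes> b" using mem by (simp add: m_lcancel)
    thus "(p, r) \<in> frac_rel R" using mem by (auto simp: p r frac_rel_iff)
  qed
qed

lemma frac_class_eq_iff:
  assumes "a \<in> carrier R" "b \<in> carrier R - {\<zero>}" "c \<in> carrier R" "d \<in> carrier R - {\<zero>}"
  shows "frac_class R a b = frac_class R c d \<longleftrightarrow> a \<otimes> d = c \<otimes> b"
  using eq_equiv_class_iff[OF equiv_frac_rel, of "(a, b)" "(c, d)"] assms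
  by (auto simp: frac_class_def frac_rel_iff)

lemma frac_class_closed:
  assumes "a \<in> carrier R" "b \<in> carrier R - {\<zero>}"
  shows "frac_class R a b \<in> carrier (Frac R)"
  using assms by (auto simp: Frac_def frac_class_def intro: quotientI)

lemma Frac_cases:
  assumes "P \<in> carrier (Frac R)"
  obtains a b where "a \<in> carrier R" "b \<in> carrier R - {\<zero>}" "P = frac_class R a b"
  using assms by (auto simp: Frac_def frac_class_def elim!: quotientE)

lemma Frac_mult:
  assumes "a \<in> carrier R" "b \<in> carrier R - {\<zero>}" "c \<in> carrier R" "d \<in> carrier R - {\<zero>}"
  shows "frac_class R a b \<otimes>\<^bsub>Frac R\<^esub> frac_class R c d = frac_class R (a \<otimes> c) (b \<otimes> d)"
proof -
  have *: "frac_class R (a' \<otimes> c') (b' \<otimes> d') = frac_class R (a \<otimes> c) (b \<otimes> d)"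
    if "(a', b') \<in> frac_class R a b" "(c', d') \<in> frac_class R c d" for a' b' c' d'
  proof -
    have mem: "a \<in> carrier R" "b \<in> carrier R" "c \<in> carrier R" "d \<in> carrier R"
      "a' \<in> carrier R" "b' \<in> carrier R" "c' \<in> carrier R" "d' \<in> carrier R"
      "b \<noteq> \<zero>" "d \<noteq> \<zero>" "b' \<noteq> \<zero>" "d' \<noteq> \<zero>"
      and 1: "a \<otimes> b' = a' \<otimes> b" and 2: "c \<otimes> d' = c' \<otimes> d"
      using that by (auto simp: frac_class_def frac_rel_iff)
    have "(a' \<otimes> c') \<otimes> (b \<otimes> d) = (a' \<otimes> b) \<otimes> (c' \<otimes> d)" using mem by (simp add: m_ac)
    also have "\<dots> = (a \<otimes> b') \<otimes> (c \<otimes> d')" by (simp only: 1 2)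
    also have "\<dots> = (a \<otimes> c) \<otimes> (b' \<otimes> d')" using mem by (simp add: m_ac)
    finally show ?thesis using mem by (subst frac_class_eq_iff) (auto simp: integral_iff)
  qed
  have ne: "(a, b) \<in> frac_class R a b" "(c, d) \<in> frac_class R c d"
    using assms by (auto simp: frac_class_def frac_rel_iff)
  show ?thesis
    unfolding Frac_def monoid.simps
    by (intro UN_constant_eq[OF ne(1)] UN_constant_eq[OF ne(2)] ballI) (simp add: *)
qed

lemma Frac_add:
  assumes "a \<in> carrier R" "b \<in> carrier R - {\<zero>}" "c \<in> carrier R" "d \<in> carrier R - {\<zero>}"
  shows "frac_class R a b \<oplus>\<^bsub>Frac R\<^esub> frac_class R c d
           = frac_class R (a \<otimes> d \<oplus> c \<otimes> b) (b \<otimes> d)"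
proof -
  have *: "frac_class R (a' \<otimes> d' \<oplus> c' \<otimes> b') (b' \<otimes> d') = frac_class R (a \<otimes> d \<oplus> c \<otimes> b) (b \<otimes> d)"
    if "(a', b') \<in> frac_class R a b" "(c', d') \<in> frac_class R c d" for a' b' c' d'
  proof -
    have mem: "a \<in> carrier R" "b \<in> carrier R" "c \<in> carrier R" "d \<in> carrier R"
      "a' \<in> carrier R" "b' \<in> carrier R" "c' \<in> carrier R" "d' \<in> carrier R"
      "b \<noteq> \<zero>" "d \<noteq> \<zero>" "b' \<noteq> \<zero>" "d' \<noteq> \<zero>"
      and 1: "a \<otimes> b' = a' \<otimes> b" and 2: "c \<otimes> d' = c' \<otimes> d"
      using that by (auto simp: frac_class_def frac_rel_iff)
    have "(a' \<otimes> d' \<oplus> c' \<otimes> b') \<otimes> (b \<otimes> d) = (a' \<otimes> b) \<otimes> (d' \<otimes> d) \<oplus> (c' \<otimes> d) \<otimes> (b' \<otimes> b)"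
      using mem by (simp add: l_distr r_distr m_ac)
    also have "\<dots> = (a \<otimes> b') \<otimes> (d' \<otimes> d) \<oplus> (c \<otimes> d') \<otimes> (b' \<otimes> b)" by (simp only: 1 2)
    also have "\<dots> = (a \<otimes> d \<oplus> c \<otimes> b) \<otimes> (b' \<otimes> d')" using mem by (simp add: l_distr r_distr m_ac)
    finally show ?thesis using mem by (subst frac_class_eq_iff) (auto simp: integral_iff)
  qed
  have ne: "(a, b) \<in> frac_class R a b" "(c, d) \<in> frac_class R c d"
    using assms by (auto simp: frac_class_def frac_rel_iff)
  show ?thesis
    unfolding Frac_def ring.simps
    by (intro UN_constant_eq[OF ne(1)] UN_constant_eq[OF ne(2)] ballI) (simp add: *)
qed

lemma Frac_one: "\<one>\<^bsub>Frac R\<^esub> = frac_class R \<one> \<one>"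
  and Frac_zero: "\<zero>\<^bsub>Frac R\<^esub> = frac_class R \<zero> \<one>"
  by (simp_all add: Frac_def)

lemma field_Frac: "field (Frac R)"
proof -
  have cl: "b \<otimes> d \<in> carrier R - {\<zero>}" if "b \<in> carrier R - {\<zero>}" "d \<in> carrier R - {\<zero>}" for b d
    using that by (auto simp: integral_iff)
  have o: "\<one> \<in> carrier R - {\<zero>}" by simp
  note fs = Frac_mult Frac_add Frac_one Frac_zero cl o frac_class_closed
  have add_closed: "P \<oplus>\<^bsub>Frac R\<^esub> Q \<in> carrier (Frac R)"
    if PQ: "P \<in> carrier (Frac R)" "Q \<in> carrier (Frac R)" for P Q
  proof -
    obtain a b where P: "a \<in> carrier R" "b \<in> carrier R - {\<zero>}" "P = frac_class R a b"
      using PQ(1) by (rule Frac_cases)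
    obtain c d where Q: "c \<in> carrier R" "d \<in> carrier R - {\<zero>}" "Q = frac_class R c d"
      using PQ(2) by (rule Frac_cases)
    show ?thesis
      unfolding P(3) Q(3) Frac_add[OF P(1,2) Q(1,2)]
      by (rule frac_class_closed) (use P(1,2) Q(1,2) cl in auto)
  qed
  have mult_closed: "P \<otimes>\<^bsub>Frac R\<^esub> Q \<in> carrier (Frac R)"
    if PQ: "P \<in> carrier (Frac R)" "Q \<in> carrier (Frac R)" for P Q
  proof -
    obtain a b where P: "a \<in> carrier R" "b \<in> carrier R - {\<zero>}" "P = frac_class R a b"
      using PQ(1) by (rule Frac_cases)
    obtain c d where Q: "c \<in> carrier R" "d \<in> carrier R - {\<zero>}" "Q = frac_class R c d"
      using PQ(2) by (rule Frac_cases)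
    show ?thesis
      unfolding P(3) Q(3) Frac_mult[OF P(1,2) Q(1,2)]
      by (rule frac_class_closed) (use P(1,2) Q(1,2) cl in auto)
  qed
  have "cring (Frac R)"
  proof (rule cringI)
    show "abelian_group (Frac R)"
    proof (rule abelian_groupI)
      fix P assume "P \<in> carrier (Frac R)"
      then obtain a b where P: "a \<in> carrier R" "b \<in> carrier R - {\<zero>}" "P = frac_class R a b"
        by (rule Frac_cases)
      show "\<exists>Q\<in>carrier (Frac R). Q \<oplus>\<^bsub>Frac R\<^esub> P = \<zero>\<^bsub>Frac R\<^esub>"
      proof (rule bexI)
        show "frac_class R (\<ominus> a) b \<in> carrier (Frac R)" using P by (auto intro: frac_class_closed)
        have "\<ominus> a \<otimes> b \<oplus> a \<otimes> b = \<zero>" using P by (simp add: l_minus l_neg)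
        thus "frac_class R (\<ominus> a) b \<oplus>\<^bsub>Frac R\<^esub> P = \<zero>\<^bsub>Frac R\<^esub>"
          using P cl by (simp add: fs frac_class_eq_iff integral_iff)
      qed
    qed (use add_closed in blast, auto elim!: Frac_cases simp: fs frac_class_eq_iff integral_iff l_distr r_distr a_ac m_ac)
    show "Group.comm_monoid (Frac R)"
      by (rule comm_monoidI, use mult_closed in blast)
        (auto elim!: Frac_cases simp: fs frac_class_eq_iff integral_iff m_ac)
  next
    fix P Q S
    assume mem: "P \<in> carrier (Frac R)" "Q \<in> carrier (Frac R)" "S \<in> carrier (Frac R)"
    obtain a b where P: "a \<in> carrier R" "b \<in> carrier R - {\<zero>}" "P = frac_class R a b"
      using mem(1) by (rule Frac_cases)
    obtain c d where Q: "c \<in> carrier R" "d \<in> carrier R - {\<zero>}" "Q = frac_class R c d"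
      using mem(2) by (rule Frac_cases)
    obtain e f where S: "e \<in> carrier R" "f \<in> carrier R - {\<zero>}" "S = frac_class R e f"
      using mem(3) by (rule Frac_cases)
    show "(P \<oplus>\<^bsub>Frac R\<^esub> Q) \<otimes>\<^bsub>Frac R\<^esub> S
            = P \<otimes>\<^bsub>Frac R\<^esub> S \<oplus>\<^bsub>Frac R\<^esub> Q \<otimes>\<^bsub>Frac R\<^esub> S"
      using P Q S by (simp add: fs frac_class_eq_iff integral_iff l_distr r_distr m_ac)
  qed
  then interpret F: cring "Frac R" .
  show ?thesis
  proof (rule F.cring_fieldI2)
    show "\<zero>\<^bsub>Frac R\<^esub> \<noteq> \<one>\<^bsub>Frac R\<^esub>" by (simp add: fs frac_class_eq_iff)
    fix P assume P_mem: "P \<in> carrier (Frac R)" and nz: "P \<noteq> \<zero>\<^bsub>Frac R\<^esub>"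
    obtain a b where P: "a \<in> carrier R" "b \<in> carrier R - {\<zero>}" "P = frac_class R a b"
      using P_mem by (rule Frac_cases)
    have a: "a \<in> carrier R - {\<zero>}" using P nz by (auto simp: Frac_zero frac_class_eq_iff)
    show "\<exists>Q\<in>carrier (Frac R). P \<otimes>\<^bsub>Frac R\<^esub> Q = \<one>\<^bsub>Frac R\<^esub>"
      using P a by (intro bexI[of _ "frac_class R b a"])
        (auto simp: fs frac_class_eq_iff integral_iff m_ac)
  qed
qed

end


section \<open>The kernel curve and its function field\<close>

text \<open>
  \<open>\<complex>[x, y]\<close> is \<^typ>\<open>complex poly poly\<close>: the outer indeterminate is \<open>y\<close>, the coefficients
  lie in \<open>\<complex>[x]\<close>.
\<close>

abbreviation polyX :: "complex poly poly" where "polyX \<equiv> [:[:0, 1:]:]"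
abbreviation polyY :: "complex poly poly" where "polyY \<equiv> [:0, 1:]"
abbreviation polyC :: "complex \<Rightarrow> complex poly poly" where "polyC c \<equiv> [:[:c:]:]"

definition degree_y :: "complex poly poly \<Rightarrow> nat" where
  "degree_y p = Polynomial.degree p"

definition degree_x :: "complex poly poly \<Rightarrow> nat" where
  "degree_x p = Max ((\<lambda>n. Polynomial.degree (Polynomial.coeff p n)) ` {..Polynomial.degree p})"

text \<open>The shift by one in the exponents comes from multiplying
  \<open>1 - t \<Sum> d i j x\<^sup>i y\<^sup>j\<close> by \<open>x y\<close>.\<close>

definition kernel_poly :: "(int \<Rightarrow> int \<Rightarrow> complex) \<Rightarrow> complex \<Rightarrow> complex poly poly" where
  "kernel_poly d t = polyX * polyY
     - polyC t * (\<Sum>i\<in>{-1, 0, 1}. \<Sum>j\<in>{-1, 0, 1}.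
         polyC (d i j) * polyX ^ nat (i + 1) * polyY ^ nat (j + 1))"

abbreviation Cxy :: "complex poly poly ring" where
  "Cxy \<equiv> ring_of_type_algebra"

definition coord_ring :: "complex poly poly \<Rightarrow> complex poly poly set ring" where
  "coord_ring K = Cxy Quot (PIdl\<^bsub>Cxy\<^esub> K)"

type_synonym curve_fun = "(complex poly poly set \<times> complex poly poly set) set"

definition function_field :: "complex poly poly \<Rightarrow> curve_fun ring" where
  "function_field K = Frac (coord_ring K)"

definition of_poly :: "complex poly poly \<Rightarrow> complex poly poly \<Rightarrow> curve_fun" where
  "of_poly K p = frac_class (coord_ring K) (PIdl\<^bsub>Cxy\<^esub> K +>\<^bsub>Cxy\<^esub> p) \<one>\<^bsub>coord_ring K\<^esub>"

definition xfun :: "complex poly poly \<Rightarrow> curve_fun" where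
  "xfun K = of_poly K polyX"

definition yfun :: "complex poly poly \<Rightarrow> curve_fun" where
  "yfun K = of_poly K polyY"

definition rat_subfield :: "complex poly poly \<Rightarrow> curve_fun \<Rightarrow> curve_fun set" where
  "rat_subfield K z = generate_field (function_field K) (insert z (range (\<lambda>c. of_poly K (polyC c))))"

lemma field_function_field:
  assumes "Factorial_Ring.irreducible K"
  shows "field (function_field K)"
proof -
  have prime: "Factorial_Ring.prime_elem K"
    using assms by (rule irreducible_imp_prime_elem)
  have K: "K \<noteq> 0" "\<not> K dvd 1" using prime by (auto simp: Factorial_Ring.prime_elem_def)
  interpret C: cring Cxy by (rule cring_from_type_algebra)
  have mem: "p \<in> PIdl\<^bsub>Cxy\<^esub> K \<longleftrightarrow> K dvd p" for p
    by (auto simp: cgenideal_def ring_of_type_algebra_def dvd_def mult.commute)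
  have "primeideal (PIdl\<^bsub>Cxy\<^esub> K) Cxy"
  proof (rule primeidealI)
    show "ideal (PIdl\<^bsub>Cxy\<^esub> K) Cxy"
      by (rule C.cgenideal_ideal) (simp add: ring_of_type_algebra_def)
    show "cring Cxy" by (rule C.is_cring)
    show "carrier Cxy \<noteq> PIdl\<^bsub>Cxy\<^esub> K"
      using K mem[of 1] by (auto simp: ring_of_type_algebra_def)
    fix a b :: "complex poly poly"
    assume "a \<otimes>\<^bsub>Cxy\<^esub> b \<in> PIdl\<^bsub>Cxy\<^esub> K"
    hence "K dvd a * b" unfolding mem by (simp add: ring_of_type_algebra_def)
    thus "a \<in> PIdl\<^bsub>Cxy\<^esub> K \<or> b \<in> PIdl\<^bsub>Cxy\<^esub> K"
      using prime by (simp add: mem prime_elem_dvd_mult_iff)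
  qed
  hence "domain (coord_ring K)"
    unfolding coord_ring_def by (rule primeideal.quotient_is_domain)
  thus ?thesis
    unfolding function_field_def by (rule domain.field_Frac)
qed


section \<open>The group of the walk\<close>

text \<open>
  Automorphisms are taken extensional, i.e. \<^const>\<open>undefined\<close> outside the carrier, so that they are
  elements of the group \<^const>\<open>BijGroup\<close> of permutations of the carrier.
\<close>

definition field_auts :: "complex poly poly \<Rightarrow> (curve_fun \<Rightarrow> curve_fun) set" where
  "field_auts K = ring_iso (function_field K) (function_field K)
                    \<inter> extensional (carrier (function_field K))"

definition nontrivial_aut_fixing ::
    "complex poly poly \<Rightarrow> curve_fun set \<Rightarrow> (curve_fun \<Rightarrow> curve_fun) \<Rightarrow> bool" where
  "nontrivial_aut_fixing K F \<sigma> \<longleftrightarrow>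
     \<sigma> \<in> field_auts K \<and> (\<forall>u\<in>F. \<sigma> u = u) \<and> (\<exists>u\<in>carrier (function_field K). \<sigma> u \<noteq> u)"

definition walk_group ::
    "complex poly poly \<Rightarrow> (curve_fun \<Rightarrow> curve_fun) \<Rightarrow> (curve_fun \<Rightarrow> curve_fun)
       \<Rightarrow> (curve_fun \<Rightarrow> curve_fun) set" where
  "walk_group K \<iota>1 \<iota>2 = generate (BijGroup (carrier (function_field K))) {\<iota>1, \<iota>2}"


section \<open>Decoupling and certificates\<close>

definition decoupling_pair ::
    "complex poly poly \<Rightarrow> curve_fun \<Rightarrow> curve_fun \<Rightarrow> curve_fun \<Rightarrow> bool" where
  "decoupling_pair K h f g \<longleftrightarrow>
     f \<in> rat_subfield K (xfun K) \<and> g \<in> rat_subfield K (yfun K) \<and>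
     h = f \<oplus>\<^bsub>function_field K\<^esub> g"

definition decoupled :: "complex poly poly \<Rightarrow> bool" where
  "decoupled K \<longleftrightarrow>
     (\<exists>f g. decoupling_pair K (xfun K \<otimes>\<^bsub>function_field K\<^esub> yfun K) f g)"

definition certificate ::
    "complex poly poly \<Rightarrow> (curve_fun \<Rightarrow> curve_fun) \<Rightarrow> curve_fun \<Rightarrow> curve_fun \<Rightarrow> bool" where
  "certificate K \<tau> b g \<longleftrightarrow>
     g \<in> carrier (function_field K) \<and> b = \<tau> g \<ominus>\<^bsub>function_field K\<^esub> g"

end

(* A decoupling pair f + g gives a certificate because i1 fixes f and i2 fixes g. Conversely, let g be a
   certificate and u = i2(g) - g. Applying i1 to the certificate equation shows i1(u) = i2(u) = -u, so
   v = u^2 lies in C(x) and in C(y), these being the fixed fields of i1 and i2. If v were not a constant,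
   writing v as a rational function in x would exhibit x as a root of a nonzero polynomial whose
   coefficients are fixed by the whole group; the same holds for y, so x and y would have finite orbits.
   An automorphism over C is determined by the images of x and y, so the group would be finite. Hence v
   and then u are constants, and u = i1(u) = -u gives u = 0. So g lies in C(y), and xy - g, being fixed
   by i1, lies in C(x). *)

theory Submission
  imports Defs
begin

section \<open>Fixed fields of quadratic extensions\<close>

text \<open>Bridges a type-class ring and a field with explicit carrier. It serves for evaluation on
  the curve from C[x,y], and from C[x] and C[y] separately.\<close>

locale type_ring_hom = field R for R :: "('a, 'm) ring_scheme" (structure) +
  fixes h :: "'c::comm_ring_1 \<Rightarrow> 'a"
  assumes closed [simp, intro]: "h a \<in> carrier R"
    and hom_add: "h (a + b) = h a \<oplus> h b"
    and hom_mult: "h (a * b) = h a \<otimes> h b"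
    and hom_one: "h 1 = \<one>"
begin

lemma hom_zero: "h 0 = \<zero>"
proof -
  have "h 0 \<oplus> h 0 = h 0 \<oplus> \<zero>" using hom_add[of 0 0] by simp
  then show ?thesis by (simp only: add.l_cancel closed zero_closed)
qed

lemma hom_minus: "h (- a) = \<ominus> h a"
proof -
  have "h (- a) \<oplus> h a = \<zero>" using hom_add[of "- a" a] hom_zero by simp
  then show ?thesis by (simp add: minus_equality)
qed

end

context field
begin

text \<open>The quadratic relation rewrites the \<open>z \<otimes> z\<close> term of a product back
  into \<open>F + F z\<close>; the other closure properties are linear.\<close>

lemma subring_simple_span:
  assumes F: "subfield F R" and z: "z \<in> carrier R" and ab: "\<alpha> \<in> F" "\<beta> \<in> F"
    and quad: "z \<otimes> z = \<beta> \<otimes> z \<oplus> \<alpha>"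
  shows "subring {s \<oplus> r \<otimes> z | s r. s \<in> F \<and> r \<in> F} R"
proof (rule subringI)
  note F1 = subfieldE(1)[OF F]
  note Fs = subringE[OF F1]
  have c [simp]: "u \<in> F \<Longrightarrow> u \<in> carrier R" for u using Fs(1) by auto
  show "{s \<oplus> r \<otimes> z | s r. s \<in> F \<and> r \<in> F} \<subseteq> carrier R" using z by auto
  show "\<one> \<in> {s \<oplus> r \<otimes> z | s r. s \<in> F \<and> r \<in> F}"
    using z Fs(2,3) by (intro CollectI exI[of _ \<one>] exI[of _ \<zero>]) auto
  fix u assume "u \<in> {s \<oplus> r \<otimes> z | s r. s \<in> F \<and> r \<in> F}"
  then obtain s r where u: "u = s \<oplus> r \<otimes> z" "s \<in> F" "r \<in> F" by blast
  have "\<ominus> u = \<ominus> s \<oplus> (\<ominus> r) \<otimes> z" using u z by (simp add: minus_add l_minus)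
  then show "\<ominus> u \<in> {s \<oplus> r \<otimes> z | s r. s \<in> F \<and> r \<in> F}" using u Fs(5) by blast
  fix v assume "v \<in> {s \<oplus> r \<otimes> z | s r. s \<in> F \<and> r \<in> F}"
  then obtain s' r' where v: "v = s' \<oplus> r' \<otimes> z" "s' \<in> F" "r' \<in> F" by blast
  have "u \<oplus> v = (s \<oplus> s') \<oplus> (r \<oplus> r') \<otimes> z" using u v z
    by (simp add: l_distr a_ac)
  then show "u \<oplus> v \<in> {s \<oplus> r \<otimes> z | s r. s \<in> F \<and> r \<in> F}" using u v Fs(7) by blast
  have "u \<otimes> v = (s \<otimes> s' \<oplus> (s \<otimes> r' \<oplus> r \<otimes> s') \<otimes> z) \<oplus> (r \<otimes> r') \<otimes> (z \<otimes> z)" using u v z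
    by (simp add: l_distr r_distr a_ac m_ac)
  also have "\<dots> = (s \<otimes> s' \<oplus> (r \<otimes> r') \<otimes> \<alpha>) \<oplus> ((s \<otimes> r' \<oplus> r \<otimes> s') \<oplus> (r \<otimes> r') \<otimes> \<beta>) \<otimes> z"
    unfolding quad using u v z ab by (simp add: l_distr r_distr a_ac m_ac)
  finally have "u \<otimes> v = (s \<otimes> s' \<oplus> (r \<otimes> r') \<otimes> \<alpha>) \<oplus> ((s \<otimes> r' \<oplus> r \<otimes> s') \<oplus> (r \<otimes> r') \<otimes> \<beta>) \<otimes> z" .
  moreover have "s \<otimes> s' \<oplus> (r \<otimes> r') \<otimes> \<alpha> \<in> F" "(s \<otimes> r' \<oplus> r \<otimes> s') \<oplus> (r \<otimes> r') \<otimes> \<beta> \<in> F"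
    by (intro Fs(6,7) u v ab)+
  ultimately show "u \<otimes> v \<in> {s \<oplus> r \<otimes> z | s r. s \<in> F \<and> r \<in> F}" by blast
qed

lemma ring_iso_simps:
  assumes "\<phi> \<in> ring_iso R R"
  shows "u \<in> carrier R \<Longrightarrow> \<phi> u \<in> carrier R"
    "u \<in> carrier R \<Longrightarrow> v \<in> carrier R \<Longrightarrow> \<phi> (u \<otimes> v) = \<phi> u \<otimes> \<phi> v"
    "u \<in> carrier R \<Longrightarrow> v \<in> carrier R \<Longrightarrow> \<phi> (u \<oplus> v) = \<phi> u \<oplus> \<phi> v"
    "\<phi> \<one> = \<one>" "\<phi> \<zero> = \<zero>"
    "u \<in> carrier R \<Longrightarrow> \<phi> (\<ominus> u) = \<ominus> \<phi> u"
    "u \<in> carrier R \<Longrightarrow> v \<in> carrier R \<Longrightarrow> \<phi> (u \<ominus> v) = \<phi> u \<ominus> \<phi> v"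
    "u \<in> carrier R \<Longrightarrow> v \<in> carrier R \<Longrightarrow> \<phi> u = \<phi> v \<longleftrightarrow> u = v"
proof -
  interpret \<phi>: ring_hom_ring R R \<phi>
    using ring_hom_ringI2 ring_axioms assms(1) by (auto simp: ring_iso_def)
  show "u \<in> carrier R \<Longrightarrow> \<phi> u \<in> carrier R"
    "u \<in> carrier R \<Longrightarrow> v \<in> carrier R \<Longrightarrow> \<phi> (u \<otimes> v) = \<phi> u \<otimes> \<phi> v"
    "u \<in> carrier R \<Longrightarrow> v \<in> carrier R \<Longrightarrow> \<phi> (u \<oplus> v) = \<phi> u \<oplus> \<phi> v"
    "\<phi> \<one> = \<one>" "\<phi> \<zero> = \<zero>"
    "u \<in> carrier R \<Longrightarrow> \<phi> (\<ominus> u) = \<ominus> \<phi> u"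
    "u \<in> carrier R \<Longrightarrow> v \<in> carrier R \<Longrightarrow> \<phi> (u \<ominus> v) = \<phi> u \<ominus> \<phi> v"
    by (simp_all add: a_minus_def)
  show "u \<in> carrier R \<Longrightarrow> v \<in> carrier R \<Longrightarrow> \<phi> u = \<phi> v \<longleftrightarrow> u = v"
    by (rule inj_on_eq_iff[OF bij_betw_imp_inj_on[OF ring_iso_memE(5)[OF assms]]])
qed

text \<open>The hypothesis \<open>frac\<close> says that the field consists of fractions over any
  subring containing \<open>F\<close> and \<open>z\<close>; it is applied to \<open>F + F z\<close>.
  There \<open>\<phi>\<close> exchanges the two roots of the quadratic, which settles both claims on
  the subring, and denominators are then cleared.\<close>

lemma fixed_field_simple_quadratic:
  assumes F: "subfield F R" and z: "z \<in> carrier R" and abc: "a \<in> F" "b \<in> F" "c \<in> F" "a \<noteq> \<zero>"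
    and quad: "a \<otimes> (z \<otimes> z) \<oplus> b \<otimes> z \<oplus> c = \<zero>"
    and frac: "\<And>S w. subring S R \<Longrightarrow> F \<subseteq> S \<Longrightarrow> z \<in> S \<Longrightarrow> w \<in> carrier R \<Longrightarrow>
       \<exists>p q. p \<in> S \<and> q \<in> S \<and> q \<noteq> \<zero> \<and> w \<otimes> q = p"
    and \<phi>: "\<phi> \<in> ring_iso R R" "\<And>u. u \<in> F \<Longrightarrow> \<phi> u = u" and nontriv: "\<exists>u\<in>carrier R. \<phi> u \<noteq> u"
    and w: "w \<in> carrier R"
  shows "\<phi> w = w \<Longrightarrow> w \<in> F" and "\<phi> (\<phi> w) = w"
proof -
  note Fs = subringE[OF subfieldE(1)[OF F]]
  note \<phi>s = ring_iso_simps[OF \<phi>(1)]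
  have c [simp]: "u \<in> F \<Longrightarrow> u \<in> carrier R" for u using Fs(1) by auto
  have [simp]: "\<phi> z \<in> carrier R" using \<phi>s z by blast
  \<comment> \<open>Coefficients of the relation made monic, in the form
    \<open>z \<otimes> z = \<beta> \<otimes> z \<oplus> \<alpha>\<close>.\<close>
  define \<alpha> \<beta> where "\<alpha> = \<ominus> (inv a \<otimes> c)" and "\<beta> = \<ominus> (inv a \<otimes> b)"
  have ia: "inv a \<in> F" "inv a \<otimes> a = \<one>" using subfield_m_inv[OF F, of a] abc by auto
  have ab: "\<alpha> \<in> F" "\<beta> \<in> F" using ia abc Fs(5,6) by (auto simp: \<alpha>_def \<beta>_def)
  have "z \<otimes> z = (inv a \<otimes> a) \<otimes> (z \<otimes> z)" using ia z by simp
  also have "\<dots> = inv a \<otimes> (a \<otimes> (z \<otimes> z) \<oplus> b \<otimes> z \<oplus> c) \<oplus> (\<beta> \<otimes> z \<oplus> \<alpha>)"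
    unfolding \<alpha>_def \<beta>_def using ia(1) abc(1-3)[THEN c] z c[OF ia(1)] by algebra
  finally have monic: "z \<otimes> z = \<beta> \<otimes> z \<oplus> \<alpha>" using quad ia ab z by simp
  define S where "S = {s \<oplus> r \<otimes> z | s r. s \<in> F \<and> r \<in> F}"
  have S: "subring S R" unfolding S_def by (rule subring_simple_span[OF F z ab monic])
  note Ss = subringE[OF S]
  have FS: "F \<subseteq> S"
  proof
    fix u assume "u \<in> F"
    then show "u \<in> S" unfolding S_def using Fs(2) z
      by (intro CollectI exI[of _ u] exI[of _ \<zero>]) auto
  qed
  have zS: "z \<in> S" unfolding S_def using Fs(2,3) z by (intro CollectI exI[of _ \<zero>] exI[of _ \<one>]) auto
  have \<phi>S: "\<phi> (s \<oplus> r \<otimes> z) = s \<oplus> r \<otimes> \<phi> z" if "s \<in> F" "r \<in> F" for s r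
    using that z \<phi>(2) by (simp add: \<phi>s)
  have frac': "\<exists>p q. p \<in> S \<and> q \<in> S \<and> q \<noteq> \<zero> \<and> w \<otimes> q = p" if "w \<in> carrier R" for w
    using frac[OF S FS zS that] .
  \<comment> \<open>If \<open>z\<close> were fixed, \<open>\<phi>\<close> would be the identity on
    \<open>S\<close> and hence on all fractions, against \<open>nontriv\<close>.\<close>
  have ne: "\<phi> z \<noteq> z"
  proof
    assume eq: "\<phi> z = z"
    have fixS: "\<phi> u = u" if "u \<in> S" for u using that \<phi>S eq by (auto simp: S_def)
    obtain u where u: "u \<in> carrier R" "\<phi> u \<noteq> u" using nontriv by blast
    obtain p q where pq: "p \<in> S" "q \<in> S" "q \<noteq> \<zero>" "u \<otimes> q = p" using frac'[OF u(1)] by blast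
    have [simp]: "q \<in> carrier R" using pq Ss(1) by auto
    have "\<phi> u \<otimes> q = u \<otimes> q" using \<phi>s(2)[of u q] u pq(1,2,4) fixS by simp
    then have "\<phi> u = u" using m_rcancel[of q "\<phi> u" u] pq u \<phi>s by auto
    with u show False by simp
  qed
  \<comment> \<open>The image of \<open>z\<close> is again a root. Subtracting the two relations and
    cancelling the factor \<open>\<phi> z \<ominus> z\<close> leaves the sum of the roots,
    \<open>\<phi> z \<oplus> z = \<beta>\<close>.\<close>
  have "\<phi> z \<otimes> \<phi> z = \<beta> \<otimes> \<phi> z \<oplus> \<alpha>"
    using arg_cong[OF monic, of \<phi>] z ab \<phi>(2) by (simp add: \<phi>s)
  then have "(\<phi> z \<ominus> z) \<otimes> (\<phi> z \<oplus> z \<ominus> \<beta>) = \<zero>"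
  proof -
    have "(\<phi> z \<ominus> z) \<otimes> (\<phi> z \<oplus> z \<ominus> \<beta>)
      = (\<phi> z \<otimes> \<phi> z \<ominus> (\<beta> \<otimes> \<phi> z \<oplus> \<alpha>)) \<ominus> (z \<otimes> z \<ominus> (\<beta> \<otimes> z \<oplus> \<alpha>))"
      using z ab[THEN c] \<open>\<phi> z \<in> carrier R\<close> by algebra
    also have "\<dots> = \<zero>" unfolding monic \<open>\<phi> z \<otimes> \<phi> z = _\<close> using z ab by (simp add: a_minus_def r_neg)
    finally show ?thesis .
  qed
  then have "\<phi> z \<oplus> z \<ominus> \<beta> = \<zero>"
    using ne z ab integral[of "\<phi> z \<ominus> z" "\<phi> z \<oplus> z \<ominus> \<beta>"] by auto
  moreover have "\<phi> z = (\<phi> z \<oplus> z \<ominus> \<beta>) \<oplus> (\<beta> \<ominus> z)"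
    using z ab[THEN c] \<open>\<phi> z \<in> carrier R\<close> by algebra
  ultimately have conj: "\<phi> z = \<beta> \<ominus> z" using z ab by simp
  have \<phi>z: "\<phi> z \<in> S" using Ss(7)[OF subsetD[OF FS ab(2)] Ss(5)[OF zS]] by (simp add: conj a_minus_def)
  have \<phi>S': "\<phi> u \<in> S" if "u \<in> S" for u
  proof -
    obtain s r where u: "u = s \<oplus> r \<otimes> z" "s \<in> F" "r \<in> F" using \<open>u \<in> S\<close> by (auto simp: S_def)
    show ?thesis unfolding u(1) \<phi>S[OF u(2,3)]
      by (intro Ss(6,7) subsetD[OF FS] u \<phi>z)
  qed
  \<comment> \<open>A fixed \<open>s \<oplus> r \<otimes> z\<close> has
    \<open>r \<otimes> \<phi> z = r \<otimes> z\<close>, so \<open>r\<close> vanishes because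
    \<open>z\<close> is moved.\<close>
  have fixF: "u \<in> F" if "u \<in> S" "\<phi> u = u" for u
  proof -
    obtain s r where u: "u = s \<oplus> r \<otimes> z" "s \<in> F" "r \<in> F" using \<open>u \<in> S\<close> by (auto simp: S_def)
    have "s \<oplus> r \<otimes> \<phi> z = s \<oplus> r \<otimes> z" using that \<phi>S u by simp
    then have "r \<otimes> \<phi> z = r \<otimes> z" using u z by simp
    then have "r = \<zero>" using ne m_lcancel[of r "\<phi> z" z] u z by auto
    then show ?thesis using u z by simp
  qed
  obtain p q where pq: "p \<in> S" "q \<in> S" "q \<noteq> \<zero>" "w \<otimes> q = p" using frac'[OF w] by blast
  have [simp]: "q \<in> carrier R" "\<phi> q \<in> carrier R" using pq Ss(1) \<phi>s by auto
  \<comment> \<open>\<open>\<phi>\<close> maps \<open>z\<close> to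
    \<open>\<beta> \<ominus> z\<close> and back, so its square is the identity on \<open>S\<close>;
    cancelling the denominator \<open>q\<close> extends this to \<open>w\<close>.\<close>
  have s2: "\<phi> (\<phi> u) = u" if "u \<in> S" for u
  proof -
    obtain s r where u: "u = s \<oplus> r \<otimes> z" "s \<in> F" "r \<in> F" using \<open>u \<in> S\<close> by (auto simp: S_def)
    have "\<phi> (\<phi> z) = z"
    proof -
      have "\<phi> (\<phi> z) = \<beta> \<ominus> \<phi> z" using \<phi>s(7)[of \<beta> z] ab z \<phi>(2) conj by simp
      also have "\<dots> = z" unfolding conj using z ab[THEN c] by algebra
      finally show ?thesis .
    qed
    then show ?thesis using u z \<phi>(2) by (simp add: \<phi>s)
  qed
  have "\<phi> (\<phi> (w \<otimes> q)) = \<phi> (\<phi> w) \<otimes> q"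
    using w s2[OF pq(2)] by (simp add: \<phi>s)
  then have "\<phi> (\<phi> w) \<otimes> q = w \<otimes> q"
    unfolding pq(4) s2[OF pq(1)] by simp
  then show "\<phi> (\<phi> w) = w" using m_rcancel[of q "\<phi> (\<phi> w)" w] pq w \<phi>s by auto
  assume fixed: "\<phi> w = w"
  \<comment> \<open>Writing \<open>w\<close> with the norm of \<open>q\<close> as denominator makes the numerator fixed as well.\<close>
  define N where "N = q \<otimes> \<phi> q"
  have "N \<noteq> \<zero>" unfolding N_def using pq \<phi>s(8)[of q \<zero>] \<phi>s(5) by (auto simp: integral_iff)
  have "\<phi> N = N" unfolding N_def using s2[OF pq(2)] by (simp add: \<phi>s m_comm)
  then have NF: "N \<in> F" using fixF[of N] pq \<phi>S' Ss(6) by (auto simp: N_def)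
  have "w \<otimes> N = p \<otimes> \<phi> q" unfolding N_def pq(4)[symmetric] using w by (simp add: m_assoc)
  then have "w \<otimes> N \<in> S" using pq \<phi>S' Ss(6) by auto
  moreover have "\<phi> (w \<otimes> N) = w \<otimes> N" using w fixed NF \<phi>s \<open>\<phi> N = N\<close> by simp
  ultimately have wN: "w \<otimes> N \<in> F" by (rule fixF)
  have iN: "inv N \<in> F" "N \<otimes> inv N = \<one>" using subfield_m_inv[OF F, of N] NF \<open>N \<noteq> \<zero>\<close> by auto
  have "(w \<otimes> N) \<otimes> inv N = w" using w iN NF by (simp add: m_assoc)
  then show "w \<in> F" using Fs(6)[OF wN iN(1)] by simp
qed

end

section \<open>Elements of a generated field as fractions\<close>

context type_ring_hom
begin

text \<open>Fractions with numerator and denominator in the range of \<open>h\<close> are closed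
  under the field operations, so induction on the generation of \<open>w\<close> suffices. Stating
  the fraction as a product avoids inverses of denominators.\<close>

lemma generate_field_fractions:
  assumes "w \<in> generate_field R (insert z (range g))" "z \<in> range h" "range g \<subseteq> range h"
  shows "\<exists>p q. h q \<noteq> \<zero> \<and> w \<otimes> h q = h p"
proof -
  have "insert z (range g) \<subseteq> carrier R" using assms(2,3) by auto
  note carr [simp] = generate_field_in_carrier[OF this]
  show ?thesis
    using assms(1)
  proof (induction rule: generate_field.induct)
    case one
    then show ?case by (intro exI[of _ 1]) (simp add: hom_one)
  next
    case (incl w)
    then obtain p where "w = h p" using assms(2,3) by auto
    then show ?case by (intro exI[of _ p] exI[of _ 1]) (simp add: hom_one)
  next
    case (a_inv w)
    note [simp] = a_inv.hyps(1)[THEN carr]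
    from a_inv obtain p q where pq: "h q \<noteq> \<zero>" "w \<otimes> h q = h p" by blast
    then show ?case by (intro exI[of _ "-p"] exI[of _ q]) (simp add: hom_minus l_minus)
  next
    case (m_inv w)
    note [simp] = m_inv.hyps(1)[THEN carr]
    have iw: "inv w \<in> carrier R" "inv w \<otimes> w = \<one>" using m_inv(1,2) field_Units by auto
    from m_inv obtain p q where pq: "h q \<noteq> \<zero>" "w \<otimes> h q = h p" by blast
    have "h p \<noteq> \<zero>" using pq m_inv(2) integral_iff[of w "h q"] by auto
    moreover have "inv w \<otimes> h p = h q" unfolding pq(2)[symmetric] using iw by (simp add: m_assoc[symmetric])
    ultimately show ?case by blast
  next
    case (eng_add w1 w2)
    note [simp] = eng_add.hyps(1,2)[THEN carr]
    from eng_add obtain p q p' q' where pq: "h q \<noteq> \<zero>" "w1 \<otimes> h q = h p" "h q' \<noteq> \<zero>" "w2 \<otimes> h q' = h p'" by blast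
    have "(w1 \<oplus> w2) \<otimes> h (q * q') = (w1 \<otimes> h q) \<otimes> h q' \<oplus> (w2 \<otimes> h q') \<otimes> h q"
      unfolding hom_mult using closed[of q] closed[of q'] eng_add.hyps(1,2)[THEN carr] by algebra
    also have "\<dots> = h (p * q' + p' * q)" by (simp add: pq hom_add hom_mult)
    finally show ?case using pq by (intro exI[of _ "p * q' + p' * q"] exI[of _ "q * q'"]) (auto simp: hom_mult integral_iff)
  next
    case (eng_mult w1 w2)
    note [simp] = eng_mult.hyps(1,2)[THEN carr]
    from eng_mult obtain p q p' q' where pq: "h q \<noteq> \<zero>" "w1 \<otimes> h q = h p" "h q' \<noteq> \<zero>" "w2 \<otimes> h q' = h p'" by blast
    have "(w1 \<otimes> w2) \<otimes> h (q * q') = (w1 \<otimes> h q) \<otimes> (w2 \<otimes> h q')"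
      by (simp add: hom_mult m_ac)
    also have "\<dots> = h (p * p')" by (simp add: pq hom_mult)
    finally show ?case using pq by (intro exI[of _ "p * p'"] exI[of _ "q * q'"]) (auto simp: hom_mult integral_iff)
  qed
qed

end

section \<open>Orbits of a generator\<close>

lemma (in ring) normalize_eq_Nil: "normalize l = [] \<Longrightarrow> set l \<subseteq> {\<zero>}"
  by (induction l) (auto split: if_splits)

text \<open>A one-variable evaluation p -> p(z), to be used once with z = x and once with z =
  y.\<close>

locale poly_ring_hom = type_ring_hom R h for R :: "('a, 'm) ring_scheme" (structure)
  and h :: "'c::field poly \<Rightarrow> 'a"
begin

abbreviation "z \<equiv> h [:0, 1:]"

lemma hom_pCons: "h (pCons a p) = h p \<otimes> z \<oplus> h [:a:]"
proof -
  have "pCons a p = p * [:0, 1:] + [:a:]" by simp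
  then show ?thesis by (simp only: hom_add hom_mult)
qed

text \<open>A nonzero constant is a unit, and a ring homomorphism into a field sends units to
  nonzero elements.\<close>

lemma hom_const_nonzero: "a \<noteq> 0 \<Longrightarrow> h [:a:] \<noteq> \<zero>"
proof
  assume "a \<noteq> 0" "h [:a:] = \<zero>"
  then have "h ([:a:] * [:inverse a:]) = \<zero>" unfolding hom_mult by simp
  moreover have "[:a:] * [:inverse a:] = 1" using \<open>a \<noteq> 0\<close> by (simp add: one_pCons)
  ultimately show False using hom_one by simp
qed

text \<open>Here \<open>l\<close> is the coefficient list, highest degree first, of \<open>p - v q\<close> as a polynomial over \<open>R\<close>.\<close>

lemma relation_list:
  fixes v
  assumes v: "v \<in> carrier R"
  defines "A \<equiv> {\<phi> \<in> ring_iso R R. (\<forall>c. \<phi> (h [:c:]) = h [:c:]) \<and> \<phi> v = v}"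
  shows "\<exists>l. set l \<subseteq> carrier R \<and> (\<forall>\<phi>\<in>A. eval l (\<phi> z) = \<phi> (h p) \<ominus> v \<otimes> \<phi> (h q)) \<and>
    (set l \<subseteq> {\<zero>} \<longrightarrow> (\<forall>i. h [:Polynomial.coeff p i:] = v \<otimes> h [:Polynomial.coeff q i:]))"
\<comment> \<open>Simultaneous induction treats the shorter polynomial as padded with zeros, so
  coefficients of equal index are always paired.\<close>
proof (induction p q rule: poly_induct2)
  case 0
  show ?case using v by (intro exI[of _ "[]"]) (auto simp: A_def hom_zero ring_iso_simps(5) a_minus_def)
next
  case (pCons a p b q)
  then obtain l where l: "set l \<subseteq> carrier R" "\<And>\<phi>. \<phi> \<in> A \<Longrightarrow> eval l (\<phi> z) = \<phi> (h p) \<ominus> v \<otimes> \<phi> (h q)"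
    "set l \<subseteq> {\<zero>} \<Longrightarrow> (\<forall>i. h [:Polynomial.coeff p i:] = v \<otimes> h [:Polynomial.coeff q i:])"
    by blast
  \<comment> \<open>The new constant coefficient; it goes to the end of the list, and evaluation
    follows Horner's scheme.\<close>
  let ?d = "h [:a:] \<ominus> v \<otimes> h [:b:]"
  show ?case
  proof (intro exI[of _ "l @ [?d]"] conjI ballI impI allI)
    show "set (l @ [?d]) \<subseteq> carrier R" using l v by auto
    fix \<phi> assume \<phi>: "\<phi> \<in> A"
    then have iso: "\<phi> \<in> ring_iso R R" and fix_c: "\<phi> (h [:c:]) = h [:c:]" for c by (auto simp: A_def)
    note s = ring_iso_simps[OF iso]
    have "eval (l @ [?d]) (\<phi> z) = (\<phi> (h p) \<ominus> v \<otimes> \<phi> (h q)) \<otimes> \<phi> z \<oplus> ?d"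
      using eval_append_aux[OF l(1), of ?d "\<phi> z"] l(2)[OF \<phi>] v s by simp
    also have "\<dots> = (\<phi> (h p) \<otimes> \<phi> z \<oplus> h [:a:]) \<ominus> v \<otimes> (\<phi> (h q) \<otimes> \<phi> z \<oplus> h [:b:])"
      using v ring_iso_memE(1)[OF iso closed[of p]] ring_iso_memE(1)[OF iso closed[of q]]
        ring_iso_memE(1)[OF iso closed[of "[:0, 1:]"]] closed[of "[:a:]"] closed[of "[:b:]"] by algebra
    also have "\<dots> = \<phi> (h (pCons a p)) \<ominus> v \<otimes> \<phi> (h (pCons b q))"
      unfolding hom_pCons[of a p] hom_pCons[of b q] using s by (simp add: ring_iso_simps[OF iso] fix_c)
    finally show "eval (l @ [?d]) (\<phi> z) = \<phi> (h (pCons a p)) \<ominus> v \<otimes> \<phi> (h (pCons b q))" .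
  next
    fix i assume "set (l @ [?d]) \<subseteq> {\<zero>}"
    then have "set l \<subseteq> {\<zero>}" "h [:a:] = v \<otimes> h [:b:]" using v by auto
    with l(3) show "h [:Polynomial.coeff (pCons a p) i:] = v \<otimes> h [:Polynomial.coeff (pCons b q) i:]"
      by (cases i) auto
  qed
qed

text \<open>Writing v = p(z)/q(z), every automorphism in question sends z to a root of the same
  polynomial p(T) - v q(T), and a nonzero polynomial over a field has finitely many roots.\<close>

lemma finite_orbit:
  assumes v: "v \<in> generate_field R (insert z (range (\<lambda>c. h [:c:])))"
    and nonconst: "v \<notin> range (\<lambda>c. h [:c:])"
  shows "finite {\<phi> z | \<phi>. \<phi> \<in> ring_iso R R \<and> (\<forall>c. \<phi> (h [:c:]) = h [:c:]) \<and> \<phi> v = v}"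
    (is "finite ?O")
proof -
  have vc: "v \<in> carrier R" using generate_field_in_carrier[OF _ v] by auto
  obtain p q where pq: "h q \<noteq> \<zero>" "v \<otimes> h q = h p"
    using generate_field_fractions[OF v] by blast
  from relation_list[OF vc, of p q] obtain l where l: "set l \<subseteq> carrier R"
    "\<And>\<phi>. \<phi> \<in> ring_iso R R \<Longrightarrow> (\<forall>c. \<phi> (h [:c:]) = h [:c:]) \<Longrightarrow> \<phi> v = v \<Longrightarrow>
       eval l (\<phi> z) = \<phi> (h p) \<ominus> v \<otimes> \<phi> (h q)"
    "set l \<subseteq> {\<zero>} \<Longrightarrow> \<forall>i. h [:Polynomial.coeff p i:] = v \<otimes> h [:Polynomial.coeff q i:]"
    by auto
  \<comment> \<open>If all coefficients vanished, \<open>v\<close> would be the quotient of two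
    constants, taken at an index where \<open>q\<close> has a nonzero coefficient.\<close>
  have ne: "normalize l \<noteq> []"
  proof
    assume "normalize l = []"
    then have eq: "h [:Polynomial.coeff p i:] = v \<otimes> h [:Polynomial.coeff q i:]" for i
      using l(3) normalize_eq_Nil by blast
    have "q \<noteq> 0" using pq hom_zero by auto
    then obtain i where i: "Polynomial.coeff q i \<noteq> 0" by (auto simp: poly_eq_iff)
    let ?a = "Polynomial.coeff p i" and ?b = "Polynomial.coeff q i"
    have "h [:?a / ?b:] = h ([:?a:] * [:inverse ?b:])" by (simp add: field_simps)
    also have "\<dots> = v \<otimes> h ([:?b:] * [:inverse ?b:])" unfolding hom_mult eq using vc by (simp add: m_assoc)
    also have "[:?b:] * [:inverse ?b:] = 1" using i by (simp add: one_pCons)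
    finally show False using nonconst hom_one vc by (metis r_one rangeI)
  qed
  \<comment> \<open>Root counting applies to lists without leading zeros; removing these does not
    change the values.\<close>
  have "?O \<subseteq> {x. is_root (normalize l) x}"
  proof
    fix x assume "x \<in> ?O"
    then obtain \<phi> where \<phi>: "\<phi> \<in> ring_iso R R" "\<forall>c. \<phi> (h [:c:]) = h [:c:]" "\<phi> v = v" and x: "x = \<phi> z" by blast
    have "\<phi> (h p) = v \<otimes> \<phi> (h q)"
      unfolding pq(2)[symmetric] using ring_iso_simps(2)[OF \<phi>(1) vc, of "h q"] \<phi>(3) by simp
    then have "eval l x = \<zero>" using l(2)[OF \<phi>] x vc ring_iso_memE(1)[OF \<phi>(1) closed] by (simp add: a_minus_def r_neg)
    then show "x \<in> {x. is_root (normalize l) x}"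
      using ne eval_normalize[OF l(1)] ring_iso_memE(1)[OF \<phi>(1) closed] by (simp add: is_root_def x)
  qed
  moreover have "normalize l \<in> carrier (poly_ring R)"
    using normalize_gives_polynomial[OF l(1)] univ_poly_carrier by blast
  ultimately show ?thesis using finite_number_of_roots finite_subset by blast
qed

end

section \<open>Fields generated by two elements over the complex numbers\<close>

text \<open>In \<^typ>\<open>complex poly poly\<close> this sends \<open>p(x)\<close> to \<open>p(y)\<close>.\<close>

definition const_poly_poly :: "'c::comm_semiring_1 poly \<Rightarrow> 'c poly poly" where
  "const_poly_poly p = map_poly (\<lambda>c. [:c:]) p"

lemma const_poly_poly_pCons [simp]: "const_poly_poly (pCons c p) = pCons [:c:] (const_poly_poly p)"
  by (simp add: const_poly_poly_def map_poly_pCons)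

lemma const_poly_poly_0 [simp]: "const_poly_poly 0 = 0"
  by (simp add: const_poly_poly_def)

lemma coeff_const_poly_poly [simp]: "Polynomial.coeff (const_poly_poly p) n = [:Polynomial.coeff p n:]"
  by (simp add: const_poly_poly_def coeff_map_poly)

lemma const_poly_poly_X: "const_poly_poly [:0, 1:] = [:0, 1:]"
  by (simp add: one_pCons)

lemma const_poly_poly_add: "const_poly_poly (p + q) = const_poly_poly p + const_poly_poly q"
  by (simp add: poly_eq_iff)

lemma const_poly_poly_smult: "const_poly_poly (Polynomial.smult c p) = Polynomial.smult [:c:] (const_poly_poly p)"
  by (rule poly_eqI) (simp add: mult.commute)

lemma const_poly_poly_mult: "const_poly_poly (p * q) = const_poly_poly p * const_poly_poly q"
  by (induction p) (simp_all add: const_poly_poly_add const_poly_poly_smult)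

lemma poly_const_poly_poly [simp]: "poly (const_poly_poly p) [:c:] = [:poly p c:]"
  by (induction p) (simp_all add: mult.commute)

text \<open>Abstracts from the construction of the function field: every element is a quotient of
  images of polynomials in x and y, and the equation of the curve is encoded in the kernel of
  \<open>e\<close>.\<close>

locale plane_curve_field = type_ring_hom R e for R :: "('a, 'm) ring_scheme" (structure)
  and e :: "complex poly poly \<Rightarrow> 'a" +
  assumes fractions: "w \<in> carrier R \<Longrightarrow> \<exists>p q. e q \<noteq> \<zero> \<and> w \<otimes> e q = e p"

text \<open>Polynomials in x are the constants in y. With the next instance, for polynomials in y,
  the orbit bound becomes available for both coordinates.\<close>

sublocale plane_curve_field \<subseteq> x: poly_ring_hom R "\<lambda>p. e [:p:]"
proof
  fix p q :: "complex poly"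
  have "[:p + q:] = [:p:] + [:q:]" "[:p * q:] = [:p:] * [:q:]" by (simp_all add: mult.commute)
  then show "e [:p + q:] = e [:p:] \<oplus> e [:q:]" "e [:p * q:] = e [:p:] \<otimes> e [:q:]"
    by (simp_all only: hom_add hom_mult)
qed (auto simp: hom_one[unfolded one_pCons] one_pCons)

sublocale plane_curve_field \<subseteq> y: poly_ring_hom R "\<lambda>p. e (const_poly_poly p)"
  by unfold_locales
    (auto simp: const_poly_poly_add const_poly_poly_mult hom_add hom_mult one_pCons hom_one[unfolded one_pCons])

context plane_curve_field
begin

lemma y_hom_pCons: "e (const_poly_poly (pCons c a)) = e (const_poly_poly a) \<otimes> e polyY \<oplus> e (polyC c)"
  using y.hom_pCons[of c a] unfolding const_poly_poly_X by simp

section \<open>The subfields C(x) and C(y) as fixed fields\<close>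

definition "subfield_of u = generate_field R (insert u (range (\<lambda>c. e (polyC c))))"

lemma subfield_subfield_of: "u \<in> carrier R \<Longrightarrow> subfield (subfield_of u) R"
  unfolding subfield_of_def by (rule generate_field_is_subfield) auto

lemma subfield_of_memI [simp, intro]: "u \<in> subfield_of u" "e (polyC c) \<in> subfield_of u"
  by (auto simp: subfield_of_def intro: generate_field.incl)

text \<open>The outer induction runs over powers of y, the inner one over the coefficient in
  C[x].\<close>

lemma hom_mem_subring:
  assumes S: "subring S R" and mem: "\<And>c. e (polyC c) \<in> S" "e polyX \<in> S" "e polyY \<in> S"
  shows "e p \<in> S"
proof (induction p)
  case 0
  then show ?case using subringE(2)[OF S] hom_zero by simp
next
  case (pCons a p)
  have a: "e [:a:] \<in> S"
  proof (induction a)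
    case 0
    then show ?case using subringE(2)[OF S] hom_zero by simp
  next
    case (pCons c a)
    then show ?case unfolding x.hom_pCons[of c a] by (intro subringE(6,7)[OF S] mem)
  qed
  have "pCons a p = p * polyY + [:a:]" by simp
  then have "e (pCons a p) = e p \<otimes> e polyY \<oplus> e [:a:]" by (simp only: hom_add hom_mult)
  then show ?case using subringE(6,7)[OF S] mem a pCons.IH by metis
qed

lemma hom_x_mem: "e [:a:] \<in> subfield_of (e polyX)"
proof (induction a)
  case 0
  then show ?case using subringE(2)[OF subfieldE(1)[OF subfield_subfield_of]] hom_zero by simp
next
  case (pCons c a)
  then show ?case unfolding x.hom_pCons[of c a]
    by (intro subringE(6,7)[OF subfieldE(1)[OF subfield_subfield_of]]) auto
qed

lemma hom_y_mem: "e (const_poly_poly a) \<in> subfield_of (e polyY)"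
proof (induction a)
  case 0
  then show ?case using subringE(2)[OF subfieldE(1)[OF subfield_subfield_of]] hom_zero by simp
next
  case (pCons c a)
  then show ?case unfolding y_hom_pCons
    by (intro subringE(6,7)[OF subfieldE(1)[OF subfield_subfield_of]]) auto
qed

text \<open>Supplies the hypothesis \<open>frac\<close> of
  \<open>fixed_field_simple_quadratic\<close> for either coordinate.\<close>

lemma fractions_mem_subring:
  assumes "subring S R" "\<And>c. e (polyC c) \<in> S" "e polyX \<in> S" "e polyY \<in> S" "w \<in> carrier R"
  shows "\<exists>p q. p \<in> S \<and> q \<in> S \<and> q \<noteq> \<zero> \<and> w \<otimes> q = p"
  using fractions[OF assms(5)] hom_mem_subring[OF assms(1-4)] by blast

text \<open>The quadratic extension is that of C(x) by y, with the equation of the curve read as a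
  polynomial in y.\<close>

lemma fixed_field_x:
  assumes nz: "e [:a:] \<noteq> \<zero>" and quad: "e [:c, b, a:] = \<zero>"
    and \<phi>: "\<phi> \<in> ring_iso R R" "\<And>u. u \<in> subfield_of (e polyX) \<Longrightarrow> \<phi> u = u"
      "\<exists>u\<in>carrier R. \<phi> u \<noteq> u"
    and w: "w \<in> carrier R"
  shows "\<phi> w = w \<Longrightarrow> w \<in> subfield_of (e polyX)" and "\<phi> (\<phi> w) = w"
proof -
  have "[:c, b, a:] = [:a:] * (polyY * polyY) + [:b:] * polyY + [:c:]" by simp
  then have quad': "e [:a:] \<otimes> (e polyY \<otimes> e polyY) \<oplus> e [:b:] \<otimes> e polyY \<oplus> e [:c:] = \<zero>"
    using quad by (simp only: hom_add hom_mult)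
  have frac: "\<exists>p q. p \<in> S \<and> q \<in> S \<and> q \<noteq> \<zero> \<and> u \<otimes> q = p"
    if "subring S R" "subfield_of (e polyX) \<subseteq> S" "e polyY \<in> S" "u \<in> carrier R" for S u
    using that subfield_of_memI by (intro fractions_mem_subring) blast+
  note * = fixed_field_simple_quadratic[OF subfield_subfield_of[OF closed] closed hom_x_mem hom_x_mem hom_x_mem nz quad' frac \<phi> w]
  show "\<phi> w = w \<Longrightarrow> w \<in> subfield_of (e polyX)" "\<phi> (\<phi> w) = w" by (rule *; assumption)+
qed

text \<open>The coordinates exchange roles: C(y) is extended by x. As y is the outer indeterminate,
  coefficients in C[y] have to be written with \<open>const_poly_poly\<close>.\<close>

lemma fixed_field_y:
  assumes nz: "e (const_poly_poly a) \<noteq> \<zero>"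
    and quad: "e (const_poly_poly a * polyX ^ 2 + const_poly_poly b * polyX + const_poly_poly c) = \<zero>"
    and \<phi>: "\<phi> \<in> ring_iso R R" "\<And>u. u \<in> subfield_of (e polyY) \<Longrightarrow> \<phi> u = u"
      "\<exists>u\<in>carrier R. \<phi> u \<noteq> u"
    and w: "w \<in> carrier R"
  shows "\<phi> w = w \<Longrightarrow> w \<in> subfield_of (e polyY)" and "\<phi> (\<phi> w) = w"
proof -
  have quad': "e (const_poly_poly a) \<otimes> (e polyX \<otimes> e polyX) \<oplus> e (const_poly_poly b) \<otimes> e polyX \<oplus> e (const_poly_poly c) = \<zero>"
    using quad by (simp only: hom_add hom_mult power2_eq_square)
  have frac: "\<exists>p q. p \<in> S \<and> q \<in> S \<and> q \<noteq> \<zero> \<and> u \<otimes> q = p"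
    if "subring S R" "subfield_of (e polyY) \<subseteq> S" "e polyX \<in> S" "u \<in> carrier R" for S u
    using that subfield_of_memI by (intro fractions_mem_subring) blast+
  note * = fixed_field_simple_quadratic[OF subfield_subfield_of[OF closed] closed hom_y_mem hom_y_mem hom_y_mem nz quad' frac \<phi> w]
  show "\<phi> w = w \<Longrightarrow> w \<in> subfield_of (e polyY)" "\<phi> (\<phi> w) = w" by (rule *; assumption)+
qed

section \<open>Automorphisms over C fixing a given element\<close>

definition auts_fixing :: "'a \<Rightarrow> ('a \<Rightarrow> 'a) set" where
  "auts_fixing v = {\<phi> \<in> ring_iso R R \<inter> extensional (carrier R). (\<forall>c. \<phi> (e (polyC c)) = e (polyC c)) \<and> \<phi> v = v}"

text \<open>The elements on which both maps agree form a subring containing all polynomials in x and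
  y. Agreement passes to quotients by cancelling the image of the denominator, and extensionality
  settles the rest.\<close>

lemma aut_eqI:
  assumes iso: "\<phi> \<in> ring_iso R R" "\<psi> \<in> ring_iso R R"
    and ext: "\<phi> \<in> extensional (carrier R)" "\<psi> \<in> extensional (carrier R)"
    and eq: "\<And>c. \<phi> (e (polyC c)) = \<psi> (e (polyC c))" "\<phi> (e polyX) = \<psi> (e polyX)" "\<phi> (e polyY) = \<psi> (e polyY)"
  shows "\<phi> = \<psi>"
proof (rule extensionalityI[OF ext])
  note s1 = ring_iso_simps[OF iso(1)] and s2 = ring_iso_simps[OF iso(2)]
  let ?S = "{u \<in> carrier R. \<phi> u = \<psi> u}"
  have "subring ?S R"
    by (rule subringI) (auto simp: s1 s2)
  then have *: "\<phi> (e p) = \<psi> (e p)" for p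
    using hom_mem_subring[of ?S p] eq by auto
  fix w assume w: "w \<in> carrier R"
  obtain p q where pq: "e q \<noteq> \<zero>" "w \<otimes> e q = e p" using fractions[OF w] by blast
  have "\<phi> w \<otimes> \<phi> (e q) = \<psi> w \<otimes> \<phi> (e q)"
    using arg_cong[OF pq(2), of \<phi>] arg_cong[OF pq(2), of \<psi>] w by (simp add: s1 s2 *)
  moreover have "\<phi> (e q) \<noteq> \<zero>" using pq(1) s1(8)[of "e q" \<zero>] s1(5) w by auto
  ultimately show "\<phi> w = \<psi> w"
    using m_rcancel[of "\<phi> (e q)" "\<phi> w" "\<psi> w"] w s1(1) s2(1) closed by blast
qed

text \<open>The images of x and y determine an automorphism, so the set embeds into the product of
  two finite orbits.\<close>

lemma finite_auts_fixing:
  assumes "v \<in> subfield_of (e polyX)" "v \<in> subfield_of (e polyY)" "v \<notin> range (\<lambda>c. e (polyC c))"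
  shows "finite (auts_fixing v)"
proof (rule inj_on_finite)
  show "inj_on (\<lambda>\<phi>. (\<phi> (e polyX), \<phi> (e polyY))) (auts_fixing v)"
    by (rule inj_onI) (auto simp: auts_fixing_def intro!: aut_eqI)
  let ?O = "\<lambda>z. {\<phi> z | \<phi>. \<phi> \<in> ring_iso R R \<and> (\<forall>c. \<phi> (e (polyC c)) = e (polyC c)) \<and> \<phi> v = v}"
  show "(\<lambda>\<phi>. (\<phi> (e polyX), \<phi> (e polyY))) ` auts_fixing v \<subseteq> ?O (e polyX) \<times> ?O (e polyY)"
    by (auto simp: auts_fixing_def)
  show "finite (?O (e polyX) \<times> ?O (e polyY))"
    using x.finite_orbit[of v] y.finite_orbit[of v, unfolded const_poly_poly_X] assms by (simp add: subfield_of_def)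
qed

text \<open>The automorphisms over C that fix \<open>v\<close> form a subgroup of the permutations
  of the carrier.\<close>

lemma generate_subset_auts_fixing:
  assumes v: "v \<in> carrier R" and H: "H \<subseteq> auts_fixing v"
  shows "generate (BijGroup (carrier R)) H \<subseteq> auts_fixing v"
proof
  \<comment> \<open>Inside \<open>Bij\<close>, the inverse and product of \<open>BijGroup\<close>
    are the restricted inverse function and \<open>compose\<close>.\<close>
  have Bij: "auts_fixing v \<subseteq> Bij (carrier R)"
    by (auto simp: auts_fixing_def Bij_def dest: ring_iso_memE(5))
  fix \<phi> assume "\<phi> \<in> generate (BijGroup (carrier R)) H"
  then show "\<phi> \<in> auts_fixing v"
  proof (induction rule: generate.induct)
    case one
    have "(\<lambda>x\<in>carrier R. x) \<in> ring_iso R R"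
      by (rule ring_iso_memI) (auto simp: bij_betw_def inj_on_def)
    then have "(\<lambda>x\<in>carrier R. x) \<in> auts_fixing v" unfolding auts_fixing_def
      using v by (intro CollectI conjI IntI allI) (simp_all del: restrict_apply add: restrict_apply')
    then show ?case by (simp only: BijGroup_def monoid.simps)
  next
    case (incl \<phi>)
    then show ?case using H by auto
  next
    case (inv \<phi>)
    then have \<phi>: "\<phi> \<in> auts_fixing v" using H by auto
    then have iso: "\<phi> \<in> ring_iso R R" by (simp add: auts_fixing_def)
    let ?\<psi> = "restrict (inv_into (carrier R) \<phi>) (carrier R)"
    note inv_iso = ring_iso_set_sym[OF ring_axioms iso]
    have "?\<psi> \<in> ring_iso R R"
      using ring_iso_memE[OF inv_iso] by (intro ring_iso_memI) (auto cong: bij_betw_cong)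
    moreover have "?\<psi> u = u" if "u \<in> carrier R" "\<phi> u = u" for u
      using that inv_into_f_f[OF bij_betw_imp_inj_on[OF ring_iso_memE(5)[OF iso]], of u] by simp
    ultimately have "?\<psi> \<in> auts_fixing v" using \<phi> v by (simp add: auts_fixing_def)
    then show ?case unfolding inv_BijGroup[OF subsetD[OF Bij \<phi>]] .
  next
    case (eng \<phi> \<psi>)
    then have iso: "\<phi> \<in> ring_iso R R" "\<psi> \<in> ring_iso R R" by (auto simp: auts_fixing_def)
    have "compose (carrier R) \<phi> \<psi> \<in> ring_iso R R"
      using bij_betw_compose[OF ring_iso_memE(5)[OF iso(2)] ring_iso_memE(5)[OF iso(1)]]
      by (intro ring_iso_memI) (auto simp: compose_eq ring_iso_memE[OF iso(1)] ring_iso_memE[OF iso(2)])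
    then have "compose (carrier R) \<phi> \<psi> \<in> auts_fixing v"
      using eng v by (simp add: auts_fixing_def compose_eq)
    moreover have "\<phi> \<in> Bij (carrier R)" "\<psi> \<in> Bij (carrier R)" using eng Bij by auto
    ultimately show ?case by (simp add: BijGroup_def)
  qed
qed

section \<open>Anti-invariant elements and certificates\<close>

lemma eq_zero_if_eq_uminus: "u \<in> carrier R \<Longrightarrow> \<ominus> u = u \<Longrightarrow> u = \<zero>"
proof -
  assume u: "u \<in> carrier R" "\<ominus> u = u"
  have "polyC 2 = 1 + 1" by (simp add: one_pCons)
  then have "e (polyC 2) = \<one> \<oplus> \<one>" by (simp only: hom_add hom_one)
  then have "e (polyC 2) \<otimes> u = u \<oplus> u" using u by (simp add: l_distr)
  also have "\<dots> = \<zero>" using u r_neg[OF u(1)] by simp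
  finally show "u = \<zero>" using x.hom_const_nonzero[of 2] u integral[of "e (polyC 2)" u] by simp
qed

text \<open>The square of \<open>u\<close> is invariant under both maps. If it were not constant,
  the infinite generated group would lie in a finite set of automorphisms; so it is constant, and
  \<open>u\<close> is a square root of a complex number.\<close>

lemma anti_invariant_zero:
  assumes \<phi>: "\<phi> \<in> ring_iso R R \<inter> extensional (carrier R)" and \<psi>: "\<psi> \<in> ring_iso R R \<inter> extensional (carrier R)"
    and const: "\<And>c. \<phi> (e (polyC c)) = e (polyC c)" "\<And>c. \<psi> (e (polyC c)) = e (polyC c)"
    and fixed_x: "\<And>w. w \<in> carrier R \<Longrightarrow> \<phi> w = w \<Longrightarrow> w \<in> subfield_of (e polyX)"
    and fixed_y: "\<And>w. w \<in> carrier R \<Longrightarrow> \<psi> w = w \<Longrightarrow> w \<in> subfield_of (e polyY)"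
    and inf: "infinite (generate (BijGroup (carrier R)) {\<phi>, \<psi>})"
    and u: "u \<in> carrier R" "\<phi> u = \<ominus> u" "\<psi> u = \<ominus> u"
  shows "u = \<zero>"
proof -
  let ?v = "u \<otimes> u"
  note s = ring_iso_simps[of \<phi>] ring_iso_simps[of \<psi>]
  have fix_v: "\<phi> ?v = ?v" "\<psi> ?v = ?v" using \<phi> \<psi> u by (simp_all add: s l_minus r_minus)
  have v: "?v \<in> subfield_of (e polyX)" "?v \<in> subfield_of (e polyY)" using fixed_x fixed_y fix_v u by auto
  have "{\<phi>, \<psi>} \<subseteq> auts_fixing ?v" using \<phi> \<psi> const fix_v by (auto simp: auts_fixing_def)
  then have "infinite (auts_fixing ?v)"
    using generate_subset_auts_fixing[of ?v] u inf by (meson finite_subset m_closed)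
  then obtain c where c: "?v = e (polyC c)" using finite_auts_fixing[OF v] by auto
  \<comment> \<open>A complex square root of \<open>c\<close>. In a field \<open>u\<close> must be
    \<open>r\<close> or \<open>\<ominus> r\<close>, and \<open>\<phi>\<close> fixes both.\<close>
  define r where "r = e (polyC (csqrt c))"
  have r: "r \<in> carrier R" "\<phi> r = r" by (simp_all add: r_def const)
  have "polyC c = polyC (csqrt c) * polyC (csqrt c)" by (use power2_csqrt[of c] in \<open>simp add: power2_eq_square\<close>)
  then have "?v = r \<otimes> r" using c by (simp only: r_def hom_mult)
  moreover have "(u \<ominus> r) \<otimes> (u \<oplus> r) = u \<otimes> u \<ominus> r \<otimes> r" using u(1) r(1) by algebra
  ultimately have "(u \<ominus> r) \<otimes> (u \<oplus> r) = \<zero>" using r by (simp add: a_minus_def r_neg)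
  then have "u \<ominus> r = \<zero> \<or> u \<oplus> r = \<zero>" using u r integral[of "u \<ominus> r" "u \<oplus> r"] by simp
  then have "u = r \<or> u = \<ominus> r" using u r minus_equality[of u r] by auto
  then have "\<phi> u = u" using r \<phi> by (auto simp: s)
  then show "u = \<zero>" using eq_zero_if_eq_uminus u by simp
qed

text \<open>Here \<open>h\<close> stands for the product xy. The defect
  \<open>\<psi> g \<ominus> g\<close> is shown to change sign under both involutions, hence to
  vanish.\<close>

lemma certificate_imp_fixed:
  assumes \<phi>: "\<phi> \<in> ring_iso R R \<inter> extensional (carrier R)" and \<psi>: "\<psi> \<in> ring_iso R R \<inter> extensional (carrier R)"
    and const: "\<And>c. \<phi> (e (polyC c)) = e (polyC c)" "\<And>c. \<psi> (e (polyC c)) = e (polyC c)"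
    and fixed_x: "\<And>w. w \<in> carrier R \<Longrightarrow> \<phi> w = w \<Longrightarrow> w \<in> subfield_of (e polyX)"
    and fixed_y: "\<And>w. w \<in> carrier R \<Longrightarrow> \<psi> w = w \<Longrightarrow> w \<in> subfield_of (e polyY)"
    and involution: "\<And>w. w \<in> carrier R \<Longrightarrow> \<phi> (\<phi> w) = w" "\<And>w. w \<in> carrier R \<Longrightarrow> \<psi> (\<psi> w) = w"
    and inf: "infinite (generate (BijGroup (carrier R)) {\<phi>, \<psi>})"
    and h: "h \<in> carrier R" and g: "g \<in> carrier R" and cert: "\<phi> h \<ominus> h = \<phi> (\<psi> g) \<ominus> g"
  shows "\<psi> g = g"
proof -
  have iso: "\<phi> \<in> ring_iso R R" "\<psi> \<in> ring_iso R R" using \<phi> \<psi> by auto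
  note s = ring_iso_simps[OF iso(1)] ring_iso_simps[OF iso(2)]
  have mem: "\<phi> h \<in> carrier R" "\<psi> g \<in> carrier R" "\<phi> g \<in> carrier R" "\<phi> (\<psi> g) \<in> carrier R"
    using s h g by auto
  \<comment> \<open>Applying the involution \<open>\<phi>\<close> to the certificate equation
    negates its left side, and so must negate its right side.\<close>
  have "h \<ominus> \<phi> h = \<psi> g \<ominus> \<phi> g"
    using arg_cong[OF cert, of \<phi>] h g mem by (simp add: s involution)
  moreover have "h \<ominus> \<phi> h = \<ominus> (\<phi> h \<ominus> h)" using h mem(1) by algebra
  ultimately have eq: "\<psi> g \<ominus> \<phi> g = \<ominus> (\<phi> (\<psi> g) \<ominus> g)" using cert by simp
  have "\<phi> (\<psi> g) \<ominus> \<phi> g = (\<psi> g \<ominus> \<phi> g) \<oplus> \<phi> (\<psi> g) \<ominus> \<psi> g" using g mem by algebra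
  also have "\<dots> = \<ominus> (\<psi> g \<ominus> g)" unfolding eq using g mem by algebra
  finally have 1: "\<phi> (\<psi> g \<ominus> g) = \<ominus> (\<psi> g \<ominus> g)" using g mem by (simp add: s)
  have "\<psi> (\<psi> g \<ominus> g) = g \<ominus> \<psi> g" using g mem by (simp add: s involution)
  also have "\<dots> = \<ominus> (\<psi> g \<ominus> g)" using g mem(2) by algebra
  finally have 2: "\<psi> (\<psi> g \<ominus> g) = \<ominus> (\<psi> g \<ominus> g)" .
  have "\<psi> g \<ominus> g = \<zero>"
    by (rule anti_invariant_zero[OF \<phi> \<psi> const fixed_x fixed_y inf _ 1 2]) (use g mem in auto)
  then show ?thesis using g mem by simp
qed

end

section \<open>The function field of the kernel curve\<close>

lemma poly_eq_quadratic:
  assumes "Polynomial.degree p \<le> 2"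
  shows "p = [:Polynomial.coeff p 0, Polynomial.coeff p 1, Polynomial.coeff p 2:]"
proof (rule poly_eqI)
  fix n :: nat
  consider "n = 0" | "n = 1" | "n = 2" | "n > 2" by linarith
  then show "Polynomial.coeff p n = Polynomial.coeff [:Polynomial.coeff p 0, Polynomial.coeff p 1, Polynomial.coeff p 2:] n"
  proof cases
    case 4
    then have n: "n = Suc (Suc (Suc (n - 3)))" by simp
    have "Polynomial.coeff [:Polynomial.coeff p 0, Polynomial.coeff p 1, Polynomial.coeff p 2:] n = 0"
      by (subst n) simp
    then show ?thesis using assms 4 by (simp add: coeff_eq_0)
  qed (simp_all add: numeral_2_eq_2)
qed

lemma degree_coeff_le_degree_x: "Polynomial.degree (Polynomial.coeff p n) \<le> degree_x p"
proof (cases "n \<le> Polynomial.degree p")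
  case True
  then show ?thesis unfolding degree_x_def by (intro Max_ge) auto
next
  case False
  then show ?thesis by (simp add: coeff_eq_0)
qed

text \<open>By comparison of degrees in y. It keeps the leading coefficient of the curve equation in
  y nonzero in the function field.\<close>

lemma not_dvd_const_if_degree_y_pos:
  assumes "degree_y K > 0" "p \<noteq> 0"
  shows "\<not> K dvd [:p:]"
  using assms dvd_imp_degree_le[of K "[:p:]"] by (auto simp: degree_y_def)

text \<open>Regroups a polynomial stored by powers of y into powers of x. Nondivisibility keeps the
  leading coefficient nonzero in the function field.\<close>

lemma quadratic_in_x:
  assumes "degree_x K = 2"
  obtains a b c where "K = const_poly_poly a * polyX ^ 2 + const_poly_poly b * polyX + const_poly_poly c"
    "\<not> K dvd const_poly_poly a"
proof
  \<comment> \<open>\<open>k i\<close> collects the coefficients of x^i into a polynomial in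
    y.\<close>
  define k where "k i = map_poly (\<lambda>r. Polynomial.coeff r i) K" for i
  have ck: "Polynomial.coeff (k i) n = Polynomial.coeff (Polynomial.coeff K n) i" for i n
    by (simp add: k_def coeff_map_poly)
  show K: "K = const_poly_poly (k 2) * polyX ^ 2 + const_poly_poly (k 1) * polyX + const_poly_poly (k 0)"
  proof (rule poly_eqI)
    fix n
    have X2: "polyX ^ 2 = [:[:0, 0, 1:]:]" by (simp add: power2_eq_square)
    show "Polynomial.coeff K n = Polynomial.coeff (const_poly_poly (k 2) * polyX ^ 2 + const_poly_poly (k 1) * polyX + const_poly_poly (k 0)) n"
      unfolding X2 by (subst poly_eq_quadratic[of "Polynomial.coeff K n"])
        (use degree_coeff_le_degree_x[of K n] assms in \<open>simp_all add: ck\<close>)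
  qed
  have "k 2 \<noteq> 0"
  proof
    assume "k 2 = 0"
    have "Polynomial.degree (Polynomial.coeff K n) \<le> 1" for n
    proof (rule degree_le, intro allI impI)
      fix i :: nat assume "1 < i"
      then consider "i = 2" | "2 < i" by linarith
      then show "Polynomial.coeff (Polynomial.coeff K n) i = 0"
      proof cases
        case 1
        then show ?thesis using ck[of 2 n] \<open>k 2 = 0\<close> by simp
      next
        case 2
        then show ?thesis using degree_coeff_le_degree_x[of K n] assms by (simp add: coeff_eq_0)
      qed
    qed
    then have "degree_x K \<le> 1" unfolding degree_x_def by (subst Max_le_iff) auto
    then show False using assms by simp
  qed
  \<comment> \<open>Specialising \<open>y\<close> to a non-root of the leading coefficient keeps the degree in \<open>x\<close> equal to 2.\<close>
  show "\<not> K dvd const_poly_poly (k 2)"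
  proof
    assume "K dvd const_poly_poly (k 2)"
    then obtain M where M: "const_poly_poly (k 2) = K * M" by (auto simp: dvd_def)
    have "finite {z. poly (k 2) z = 0}" using poly_roots_finite[OF \<open>k 2 \<noteq> 0\<close>] .
    then obtain z where z: "poly (k 2) z \<noteq> 0" using infinite_UNIV_char_0[where 'a = complex] by (metis (mono_tags) UNIV_eq_I mem_Collect_eq)
    have "poly K [:z:] = [:poly (k 0) z, poly (k 1) z, poly (k 2) z:]"
      by (subst K) (simp add: power2_eq_square)
    then have deg: "Polynomial.degree (poly K [:z:]) = 2" using z by simp
    have "[:poly (k 2) z:] = poly K [:z:] * poly M [:z:]" using arg_cong[OF M, of "\<lambda>p. poly p [:z:]"] by simp
    then have "poly K [:z:] dvd [:poly (k 2) z:]" by simp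
    then show False using dvd_imp_degree_le[of "poly K [:z:]" "[:poly (k 2) z:]"] z deg by simp
  qed
qed

section \<open>The coordinate ring and its fraction field\<close>

text \<open>In the factorial ring C[x,y] an irreducible element is prime, so it generates a prime
  ideal.\<close>

lemma coord_ring_irreducible:
  assumes "Factorial_Ring.irreducible K"
  shows "ideal (PIdl\<^bsub>Cxy\<^esub> K) Cxy" "p \<in> PIdl\<^bsub>Cxy\<^esub> K \<longleftrightarrow> K dvd p" "domain (coord_ring K)"
proof -
  have prime: "Factorial_Ring.prime_elem K"
    using assms by (rule irreducible_imp_prime_elem)
  interpret C: cring Cxy by (rule cring_from_type_algebra)
  have mem: "p \<in> PIdl\<^bsub>Cxy\<^esub> K \<longleftrightarrow> K dvd p" for p
    by (auto simp: cgenideal_def ring_of_type_algebra_def dvd_def mult.commute)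
  then show "p \<in> PIdl\<^bsub>Cxy\<^esub> K \<longleftrightarrow> K dvd p" .
  show I: "ideal (PIdl\<^bsub>Cxy\<^esub> K) Cxy"
    by (rule C.cgenideal_ideal) (simp add: ring_of_type_algebra_def)
  have "primeideal (PIdl\<^bsub>Cxy\<^esub> K) Cxy"
  proof (rule primeidealI[OF I C.is_cring])
    show "carrier Cxy \<noteq> PIdl\<^bsub>Cxy\<^esub> K"
      using prime mem[of 1] by (auto simp: ring_of_type_algebra_def Factorial_Ring.prime_elem_def)
    fix a b :: "complex poly poly"
    assume "a \<otimes>\<^bsub>Cxy\<^esub> b \<in> PIdl\<^bsub>Cxy\<^esub> K"
    then have "K dvd a * b" unfolding mem by (simp add: ring_of_type_algebra_def)
    then show "a \<in> PIdl\<^bsub>Cxy\<^esub> K \<or> b \<in> PIdl\<^bsub>Cxy\<^esub> K"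
      using prime by (simp add: mem prime_elem_dvd_mult_iff)
  qed
  then show "domain (coord_ring K)"
    unfolding coord_ring_def by (rule primeideal.quotient_is_domain)
qed

text \<open>Composes the quotient map with the embedding of a domain into its fractions; the kernel
  of the composite is the ideal generated by \<open>K\<close>.\<close>

lemma function_field_of_poly:
  assumes "Factorial_Ring.irreducible K"
  shows "plane_curve_field (function_field K) (of_poly K)"
    and "of_poly K p = \<zero>\<^bsub>function_field K\<^esub> \<longleftrightarrow> K dvd p"
proof -
  interpret C: cring Cxy by (rule cring_from_type_algebra)
  interpret D: domain "coord_ring K" by (rule coord_ring_irreducible[OF assms])
  interpret F: field "function_field K" by (rule field_function_field[OF assms])
  interpret I: ideal "PIdl\<^bsub>Cxy\<^esub> K" Cxy by (rule coord_ring_irreducible[OF assms])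
  define \<pi> where "\<pi> p = PIdl\<^bsub>Cxy\<^esub> K +>\<^bsub>Cxy\<^esub> p" for p
  have car: "carrier Cxy = UNIV" by (simp add: ring_of_type_algebra_def)
  have hom: "\<pi> \<in> ring_hom Cxy (coord_ring K)" unfolding \<pi>_def coord_ring_def by (rule I.rcos_ring_hom)
  have \<pi>: "\<pi> p \<in> carrier (coord_ring K)" "\<pi> (p + q) = \<pi> p \<oplus>\<^bsub>coord_ring K\<^esub> \<pi> q"
    "\<pi> (p * q) = \<pi> p \<otimes>\<^bsub>coord_ring K\<^esub> \<pi> q" "\<pi> 1 = \<one>\<^bsub>coord_ring K\<^esub>" for p q
    using ring_hom_memE[OF hom] unfolding car by (simp_all add: ring_of_type_algebra_def)
  have e: "of_poly K p = frac_class (coord_ring K) (\<pi> p) \<one>\<^bsub>coord_ring K\<^esub>" for p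
    by (simp add: of_poly_def \<pi>_def)
  \<comment> \<open>Lifts the numerator and denominator of a fraction to polynomials.\<close>
  have surj: "\<exists>p. P = \<pi> p" if "P \<in> carrier (coord_ring K)" for P
    using that by (auto simp: coord_ring_def FactRing_def A_RCOSETS_def' \<pi>_def)
  have zero: "\<pi> p = \<zero>\<^bsub>coord_ring K\<^esub> \<longleftrightarrow> K dvd p" for p
  proof -
    have "\<pi> p = \<zero>\<^bsub>coord_ring K\<^esub> \<longleftrightarrow> PIdl\<^bsub>Cxy\<^esub> K +>\<^bsub>Cxy\<^esub> p = PIdl\<^bsub>Cxy\<^esub> K"
      by (simp add: \<pi>_def coord_ring_def FactRing_def)
    also have "\<dots> \<longleftrightarrow> p \<in> PIdl\<^bsub>Cxy\<^esub> K"
      using I.a_rcos_self I.a_rcos_const by (metis UNIV_I car)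
    also have "\<dots> \<longleftrightarrow> K dvd p" by (rule coord_ring_irreducible[OF assms])
    finally show ?thesis .
  qed
  show nz: "of_poly K p = \<zero>\<^bsub>function_field K\<^esub> \<longleftrightarrow> K dvd p" for p
    unfolding e function_field_def D.Frac_zero using \<pi>(1)[of p] zero[of p] by (simp add: D.frac_class_eq_iff)
  show "plane_curve_field (function_field K) (of_poly K)"
  proof
    fix p q
    show "of_poly K p \<in> carrier (function_field K)"
      unfolding e function_field_def by (rule D.frac_class_closed) (auto simp: \<pi>)
    show "of_poly K (p + q) = of_poly K p \<oplus>\<^bsub>function_field K\<^esub> of_poly K q"
      unfolding e function_field_def by (subst D.Frac_add) (auto simp: \<pi>)
    show "of_poly K (p * q) = of_poly K p \<otimes>\<^bsub>function_field K\<^esub> of_poly K q"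
      unfolding e function_field_def by (subst D.Frac_mult) (auto simp: \<pi>)
    show "of_poly K 1 = \<one>\<^bsub>function_field K\<^esub>"
      unfolding e function_field_def D.Frac_one by (simp add: \<pi>)
  next
    fix w assume "w \<in> carrier (function_field K)"
    then obtain P Q where PQ: "P \<in> carrier (coord_ring K)" "Q \<in> carrier (coord_ring K) - {\<zero>\<^bsub>coord_ring K\<^esub>}"
      "w = frac_class (coord_ring K) P Q"
      unfolding function_field_def by (rule D.Frac_cases)
    obtain p q where pq: "P = \<pi> p" "Q = \<pi> q" using surj PQ by blast
    have "of_poly K q \<noteq> \<zero>\<^bsub>function_field K\<^esub>" using nz zero PQ pq by simp
    moreover have "w \<otimes>\<^bsub>function_field K\<^esub> of_poly K q = of_poly K p"
      unfolding PQ(3) e function_field_def using PQ(1,2) pq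
      by (subst D.Frac_mult) (auto simp: D.frac_class_eq_iff)
    ultimately show "\<exists>p q. of_poly K q \<noteq> \<zero>\<^bsub>function_field K\<^esub> \<and> w \<otimes>\<^bsub>function_field K\<^esub> of_poly K q = of_poly K p"
      by blast
  qed
qed

section \<open>Decoupling pairs and certificates on the kernel curve\<close>

theorem proposition3p9:
  fixes d :: "int \<Rightarrow> int \<Rightarrow> complex" and t :: complex
    and \<iota>1 \<iota>2 :: "curve_fun \<Rightarrow> curve_fun"
  defines "K \<equiv> kernel_poly d t"
  defines "L \<equiv> function_field K"
  defines "x \<equiv> xfun K" and "y \<equiv> yfun K"
  defines "\<tau> \<equiv> compose (carrier L) \<iota>1 \<iota>2"
  defines "b \<equiv> x \<otimes>\<^bsub>L\<^esub> (\<iota>1 y \<ominus>\<^bsub>L\<^esub> y)"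
  assumes transcendental_t: "\<not> Polynomial.algebraic t"
    and irreducible_K: "Factorial_Ring.irreducible K"
    and degree_K: "degree_x K = 2" "degree_y K = 2"
    and iota1: "nontrivial_aut_fixing K (rat_subfield K x) \<iota>1"
    and iota2: "nontrivial_aut_fixing K (rat_subfield K y) \<iota>2"
    and infinite_group: "infinite (walk_group K \<iota>1 \<iota>2)"
  shows "(decoupled K \<longleftrightarrow> (\<exists>g. certificate K \<tau> b g)) \<and>
         (\<forall>f g. decoupling_pair K (x \<otimes>\<^bsub>L\<^esub> y) f g \<longrightarrow> certificate K \<tau> b g) \<and>
         (\<forall>g. certificate K \<tau> b g \<longrightarrow> decoupling_pair K (x \<otimes>\<^bsub>L\<^esub> y) (x \<otimes>\<^bsub>L\<^esub> y \<ominus>\<^bsub>L\<^esub> g) g)"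
proof -
  interpret L: plane_curve_field L "of_poly K"
    unfolding L_def by (rule function_field_of_poly(1)[OF irreducible_K])
  note zero_iff = function_field_of_poly(2)[OF irreducible_K, folded L_def]
  have rat: "rat_subfield K u = L.subfield_of u" for u
    unfolding rat_subfield_def L.subfield_of_def by (simp only: L_def)
  have xy: "x = of_poly K polyX" "y = of_poly K polyY"
    by (simp_all add: x_def y_def xfun_def yfun_def)
  have aut1: "\<iota>1 \<in> ring_iso L L \<inter> extensional (carrier L)" "\<And>u. u \<in> L.subfield_of x \<Longrightarrow> \<iota>1 u = u"
      "\<exists>u\<in>carrier L. \<iota>1 u \<noteq> u"
    and aut2: "\<iota>2 \<in> ring_iso L L \<inter> extensional (carrier L)" "\<And>u. u \<in> L.subfield_of y \<Longrightarrow> \<iota>2 u = u"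
      "\<exists>u\<in>carrier L. \<iota>2 u \<noteq> u"
    using iota1 iota2 by (auto simp: nontrivial_aut_fixing_def field_auts_def rat L_def)
  then have iso: "\<iota>1 \<in> ring_iso L L" "\<iota>2 \<in> ring_iso L L" by auto
  note s = L.ring_iso_simps[OF iso(1)] L.ring_iso_simps[OF iso(2)]
  \<comment> \<open>First reading of \<open>K\<close>: quadratic in y over C(x). It identifies the
    fixed field of \<open>\<iota>1\<close> and makes \<open>\<iota>1\<close> an involution.\<close>
  define A B C where "A = Polynomial.coeff K 2" and "B = Polynomial.coeff K 1" and "C = Polynomial.coeff K 0"
  have K1: "K = [:C, B, A:]" unfolding A_def B_def C_def
    by (rule poly_eq_quadratic) (use degree_K in \<open>simp add: degree_y_def\<close>)
  have "A \<noteq> 0" using degree_K(2) unfolding A_def degree_y_def by (metis leading_coeff_0_iff degree_0 zero_neq_numeral)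
  then have nz1: "of_poly K [:A:] \<noteq> \<zero>\<^bsub>L\<^esub>" using not_dvd_const_if_degree_y_pos[of K A] degree_K zero_iff by simp
  have quad1: "of_poly K [:C, B, A:] = \<zero>\<^bsub>L\<^esub>" using zero_iff[of K] K1 by simp
  note fixed1 = L.fixed_field_x[OF nz1 quad1 iso(1) aut1(2,3)[unfolded xy]]
  \<comment> \<open>Second reading of \<open>K\<close>: quadratic in x over C(y), with the same
    conclusions for \<open>\<iota>2\<close>.\<close>
  obtain A' B' C' where K2: "K = const_poly_poly A' * polyX ^ 2 + const_poly_poly B' * polyX + const_poly_poly C'"
    and "\<not> K dvd const_poly_poly A'" using quadratic_in_x[OF degree_K(1)] by blast
  then have nz2: "of_poly K (const_poly_poly A') \<noteq> \<zero>\<^bsub>L\<^esub>" using zero_iff by simp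
  have quad2: "of_poly K (const_poly_poly A' * polyX ^ 2 + const_poly_poly B' * polyX + const_poly_poly C') = \<zero>\<^bsub>L\<^esub>"
    using zero_iff[of K] K2 by simp
  note fixed2 = L.fixed_field_y[OF nz2 quad2 iso(2) aut2(2,3)[unfolded xy]]
  have x: "x \<in> carrier L" "\<iota>1 x = x" and y: "y \<in> carrier L" using aut1(2)[of x] by (auto simp: xy)
  have iy: "\<iota>1 y \<in> carrier L" using s y by auto
  have const: "\<iota>1 (of_poly K (polyC c)) = of_poly K (polyC c)" "\<iota>2 (of_poly K (polyC c)) = of_poly K (polyC c)" for c
    using aut1(2) aut2(2) by auto
  let ?h = "x \<otimes>\<^bsub>L\<^esub> y"
  have h: "?h \<in> carrier L" using x y by simp
  \<comment> \<open>Since \<open>\<iota>1\<close> fixes \<open>x\<close>, the element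
    \<open>b\<close> is the difference of xy and its image under \<open>\<iota>1\<close>.\<close>
  have b: "b = \<iota>1 ?h \<ominus>\<^bsub>L\<^esub> ?h"
    unfolding b_def using x y iy by (simp add: s L.r_distr L.r_minus a_minus_def)
  \<comment> \<open>\<open>compose\<close> is the true composition on the carrier, so the membership
    of \<open>g\<close> is used to unfold \<open>\<tau>\<close>.\<close>
  have cert_iff: "certificate K \<tau> b g \<longleftrightarrow> g \<in> carrier L \<and> \<iota>1 ?h \<ominus>\<^bsub>L\<^esub> ?h = \<iota>1 (\<iota>2 g) \<ominus>\<^bsub>L\<^esub> g" for g
    unfolding certificate_def L_def[symmetric] \<tau>_def b by (intro conj_cong refl) (simp only: compose_eq)
  have sub: "u \<in> carrier L" if "u \<in> L.subfield_of x \<or> u \<in> L.subfield_of y" for u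
    using that L.subfield_subfield_of[OF x(1)] L.subfield_subfield_of[OF y] subfieldE(3) by blast
  have 1: "certificate K \<tau> b g" if "decoupling_pair K ?h f g" for f g
  proof -
    from that have fg: "f \<in> L.subfield_of x" "g \<in> L.subfield_of y" "?h = f \<oplus>\<^bsub>L\<^esub> g"
      unfolding decoupling_pair_def rat L_def[symmetric] x_def[symmetric] y_def[symmetric] by blast+
    have mem: "f \<in> carrier L" "g \<in> carrier L" "\<iota>1 g \<in> carrier L" using fg sub s by auto
    \<comment> \<open>The fixed summand \<open>f\<close> cancels, and \<open>\<iota>2\<close> fixes
      \<open>g\<close>, so what remains is \<open>\<tau>\<close> applied to \<open>g\<close>, minus
      \<open>g\<close>.\<close>
    have "\<iota>1 ?h \<ominus>\<^bsub>L\<^esub> ?h = (f \<oplus>\<^bsub>L\<^esub> \<iota>1 g) \<ominus>\<^bsub>L\<^esub> (f \<oplus>\<^bsub>L\<^esub> g)" unfolding fg(3) using mem aut1(2)[OF fg(1)] by (simp add: s)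
    also have "\<dots> = \<iota>1 (\<iota>2 g) \<ominus>\<^bsub>L\<^esub> g" unfolding aut2(2)[OF fg(2)] using mem by algebra
    finally show ?thesis unfolding cert_iff using mem(2) by blast
  qed
  have 2: "decoupling_pair K ?h (?h \<ominus>\<^bsub>L\<^esub> g) g" if "certificate K \<tau> b g" for g
  proof -
    from that have g: "g \<in> carrier L" "\<iota>1 ?h \<ominus>\<^bsub>L\<^esub> ?h = \<iota>1 (\<iota>2 g) \<ominus>\<^bsub>L\<^esub> g" unfolding cert_iff by blast+
    have inf: "infinite (generate (BijGroup (carrier L)) {\<iota>1, \<iota>2})"
      using infinite_group by (simp add: walk_group_def L_def)
    have gg: "\<iota>2 g = g"
      by (rule L.certificate_imp_fixed[OF aut1(1) aut2(1) const fixed1(1) fixed2(1) fixed1(2) fixed2(2) inf h g])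
    have mem: "\<iota>1 ?h \<in> carrier L" "\<iota>1 g \<in> carrier L" using s h g by auto
    \<comment> \<open>As \<open>\<iota>2\<close> fixes \<open>g\<close>, the certificate equation
      equates the changes of xy and of \<open>g\<close> under \<open>\<iota>1\<close>, so their
      difference is fixed.\<close>
    have "\<iota>1 (?h \<ominus>\<^bsub>L\<^esub> g) = \<iota>1 ?h \<ominus>\<^bsub>L\<^esub> \<iota>1 g" using h g s by simp
    also have "\<dots> = (\<iota>1 ?h \<ominus>\<^bsub>L\<^esub> ?h) \<oplus>\<^bsub>L\<^esub> (?h \<ominus>\<^bsub>L\<^esub> \<iota>1 g)" using h mem by algebra
    also have "\<dots> = ?h \<ominus>\<^bsub>L\<^esub> g" unfolding g(2) gg using h g(1) mem(2) by algebra
    finally have "?h \<ominus>\<^bsub>L\<^esub> g \<in> L.subfield_of x" using fixed1(1) h g by (simp add: xy)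
    moreover have "g \<in> L.subfield_of y" using fixed2(1) g gg by (simp add: xy)
    moreover have "?h = (?h \<ominus>\<^bsub>L\<^esub> g) \<oplus>\<^bsub>L\<^esub> g" using h g(1) by algebra
    ultimately show ?thesis
      unfolding decoupling_pair_def rat L_def[symmetric] x_def[symmetric] y_def[symmetric] by blast
  qed
  show ?thesis using 1 2
    unfolding decoupled_def L_def[symmetric] x_def[symmetric] y_def[symmetric] by blast
qed

end
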